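(* Let $\pi=(d_1,\dots,d_n)$ be a graphic sequence with $d_1\ge d_2\ge\cdots\ge d_n$. Then there exists a simple graph $G$ with vertex set $V(G)=\{v_1,\dots,v_n\}$ and $d_G(v_i)=d_i$ for all $i\in[n]$ such that, if $H$ denotes the parity bisection of $G$ (with respect to this labeling), then $d_H(v_i)\ge (d_G(v_i)-1)/2$ for all $i\in[n]$.
   Context: A sequence of nonnegative integers is graphic if it is the degree sequence of some finite simple graph. $[k]=\{1,\dots,k\}$. For a graph $G$ with vertices labeled $V(G)=\{v_1,\dots,v_n\}$, the parity bisection of $G$ is the spanning bipartite subgraph $H$ with partition sets $V_1=\{v_j: j \text{ odd}\}$ and $V_2=\{v_j: j\text{ even}\}$ and edge set $E(H)=\{uv\in E(G): u\in V_1, v\in V_2\}$. $d_G(v)$ denotes the degree of $v$ in $G$. *)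

theory Defs
  imports Complex_Main
begin

definition simple_graph_on :: "nat \<Rightarrow> (nat \<Rightarrow> nat \<Rightarrow> bool) \<Rightarrow> bool" where
  "simple_graph_on n E \<longleftrightarrow>
     (\<forall>u v. E u v \<longrightarrow> u \<in> {1..n} \<and> v \<in> {1..n}) \<and>
     (\<forall>u v. E u v \<longrightarrow> E v u) \<and>
     (\<forall>u. \<not> E u u)"

definition degree :: "nat \<Rightarrow> (nat \<Rightarrow> nat \<Rightarrow> bool) \<Rightarrow> nat \<Rightarrow> nat" where
  "degree n E v = card {u \<in> {1..n}. E v u}"

definition graphic :: "nat \<Rightarrow> (nat \<Rightarrow> nat) \<Rightarrow> bool" where
  "graphic n d \<longleftrightarrow> (\<exists>E. simple_graph_on n E \<and> (\<forall>i\<in>{1..n}. degree n E i = d i))"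

definition parity_bisection :: "(nat \<Rightarrow> nat \<Rightarrow> bool) \<Rightarrow> nat \<Rightarrow> nat \<Rightarrow> bool" where
  "parity_bisection E u v \<longleftrightarrow> E u v \<and> ((odd u \<and> even v) \<or> (even u \<and> odd v))"

end

theory Submission
  imports Defs
begin

text \<open>Let the balance of a vertex be its number of neighbours of the other parity minus its number of
  neighbours of its own parity; the goal is a realization in which every balance is at least \<open>-1\<close>.
  Among the realizations with the largest total balance one repairs first the odd and then the even
  labels. If a class cannot be repaired, take a deficient vertex \<open>v\<close> with all larger labels of its
  class good and with balance \<open>\<le> -2\<close> as large as possible. Some \<open>y\<close> of the other parity is not
  adjacent to \<open>v\<close> (a hole) and some \<open>x\<close> of the same parity is (a peg). Two-edge switches that
  move the hole and the peg around within the family of extremal realizations show that certain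
  neighbourhoods in one fixed member \<open>G\<close> are complete. They also single out a set \<open>R\<close>
  containing \<open>v\<close>, all of whose members have nonpositive balance, so that the balances over \<open>R\<close>
  sum to at most \<open>-2\<close>. Counting the edges at \<open>R\<close> by pairing every label \<open>b\<close> with
  \<open>b + 1\<close>, where \<open>d\<^sub>b \<ge> d\<^sub>b\<^sub>+\<^sub>1\<close>, bounds the same sum from below and gives a contradiction.\<close>

section \<open>Balances and switches\<close>

text \<open>Twice the degree in the bisection is degree plus balance, so the bound says exactly that
  the balance is at least -1. Maximality of the total turns every switch that would raise it into a
  forced edge; a switch that keeps it only moves balance around, and the choice of \<open>v\<close>
  limits that. The obstacle is label 1. In the sum over \<open>R\<close>, each label
  \<open>b + 1\<close> of the class of \<open>v\<close> is charged against \<open>b\<close>. For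
  even \<open>v\<close> nothing is left over. For odd \<open>v\<close>, label 1 has no partner and
  can cost up to \<open>card R\<close>, so the pairs must supply a unit of slack for each member of
  \<open>R\<close> other than \<open>v\<close>: apart from the correction at the pair
  \<open>v - 1, v\<close>, the sum is then at least -1, against at most -2. To find this slack, the
  odd stage leaves the balances of the even labels free, so that holes can be ranked by label alone.
  Hence the odd class comes before the even one, whose family fixes all balances and so cannot spoil
  what was gained.\<close>

definition chi :: "nat \<Rightarrow> nat \<Rightarrow> int" where
  "chi u w = (if even u = even w then -1 else 1)"

definition nb :: "nat \<Rightarrow> (nat \<Rightarrow> nat \<Rightarrow> bool) \<Rightarrow> nat \<Rightarrow> nat set" where
  "nb n E u = {w \<in> {1..n}. E u w}"

definition bal :: "nat \<Rightarrow> (nat \<Rightarrow> nat \<Rightarrow> bool) \<Rightarrow> nat \<Rightarrow> int" where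
  "bal n E u = (\<Sum>w\<in>nb n E u. chi u w)"

definition total :: "nat \<Rightarrow> (nat \<Rightarrow> nat \<Rightarrow> bool) \<Rightarrow> int" where
  "total n E = (\<Sum>u\<in>{1..n}. bal n E u)"

definition realizes :: "nat \<Rightarrow> (nat \<Rightarrow> nat) \<Rightarrow> (nat \<Rightarrow> nat \<Rightarrow> bool) \<Rightarrow> bool" where
  "realizes n d E \<longleftrightarrow> simple_graph_on n E \<and> (\<forall>i\<in>{1..n}. degree n E i = d i)"

text \<open>In most uses \<open>a\<close> is \<open>v\<close>: the switch gives up its neighbour
  \<open>b\<close>, fills its hole \<open>y\<close>, and \<open>c\<close> makes the opposite
  exchange.\<close>

definition switch :: "nat \<Rightarrow> nat \<Rightarrow> nat \<Rightarrow> nat \<Rightarrow> (nat \<Rightarrow> nat \<Rightarrow> bool) \<Rightarrow> nat \<Rightarrow> nat \<Rightarrow> bool" where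
  "switch a b c y E u w \<longleftrightarrow>
     E u w \<and> {u, w} \<noteq> {a, b} \<and> {u, w} \<noteq> {c, y} \<or> {u, w} = {a, y} \<or> {u, w} = {c, b}"

lemma chi_commute: "chi u w = chi w u"
  by (auto simp: chi_def)

lemma finite_nb [simp]: "finite (nb n E u)"
  by (simp add: nb_def)

lemma degree_nb: "degree n E u = card (nb n E u)"
  by (simp add: degree_def nb_def)

lemma realizesD:
  assumes "realizes n d E"
  shows realizes_sym: "E u w \<Longrightarrow> E w u"
    and realizes_irrefl: "\<not> E u u"
    and realizes_V1: "E u w \<Longrightarrow> u \<in> {1..n}"
    and realizes_V2: "E u w \<Longrightarrow> w \<in> {1..n}"
    and realizes_card: "u \<in> {1..n} \<Longrightarrow> card (nb n E u) = d u"
  using assms unfolding realizes_def simple_graph_on_def degree_nb by blast+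

lemma realizes_comm: "realizes n d E \<Longrightarrow> E u w \<longleftrightarrow> E w u"
  using realizes_sym by blast

locale switching =
  fixes n d E a b c y
  assumes gr: "realizes n d E"
    and ab: "E a b" and cy: "E c y" and nay: "\<not> E a y" and ncb: "\<not> E c b"
    and ac: "a \<noteq> c" and bny: "b \<noteq> y" and ay: "a \<noteq> y" and cb: "c \<noteq> b"
begin

lemma dist: "a \<noteq> b" "c \<noteq> y"
  using ab cy realizes_irrefl[OF gr] by auto

lemma inV: "a \<in> {1..n}" "b \<in> {1..n}" "c \<in> {1..n}" "y \<in> {1..n}"
  using ab cy realizes_V1[OF gr] realizes_V2[OF gr] by blast+

lemma reversed_pairs: "E b a" "E y c" "\<not> E y a" "\<not> E b c"
  using ab cy nay ncb realizes_sym[OF gr] by blast+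

abbreviation "E' \<equiv> switch a b c y E"

lemma nb_switch:
  "nb n E' a = insert y (nb n E a - {b})"
  "nb n E' b = insert c (nb n E b - {a})"
  "nb n E' c = insert b (nb n E c - {y})"
  "nb n E' y = insert a (nb n E y - {c})"
  "u \<notin> {a,b,c,y} \<Longrightarrow> nb n E' u = nb n E u"
  using inV dist ac bny ay cb
  by (auto simp: nb_def switch_def doubleton_eq_iff)

lemma realizes_switch: "realizes n d E'"
proof -
  have simple: "simple_graph_on n E'"
    using gr inV dist ac bny ay cb unfolding realizes_def simple_graph_on_def switch_def
    by (auto simp: doubleton_eq_iff)
  have card: "card (insert q (S - {p})) = card S" if "finite S" "p \<in> S" "q \<notin> S" for S :: "nat set" and p q
    using that by (metis DiffD1 card.insert card.remove finite_Diff)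
  have mem: "b \<in> nb n E a" "y \<notin> nb n E a" "a \<in> nb n E b" "c \<notin> nb n E b"
    "y \<in> nb n E c" "b \<notin> nb n E c" "c \<in> nb n E y" "a \<notin> nb n E y"
    using ab cy nay ncb reversed_pairs inV by (auto simp: nb_def)
  have "card (nb n E' u) = card (nb n E u)" for u
  proof (cases "u \<in> {a,b,c,y}")
    case True
    have "card (nb n E' a) = card (nb n E a)" "card (nb n E' b) = card (nb n E b)"
      "card (nb n E' c) = card (nb n E c)" "card (nb n E' y) = card (nb n E y)"
      unfolding nb_switch by (rule card; rule finite_nb mem)+
    with True show ?thesis by blast
  next
    case False
    then show ?thesis by (simp add: nb_switch)
  qed
  then have "degree n E' u = degree n E u" for u
    by (simp add: degree_nb)
  then show ?thesis
    using gr simple by (auto simp: realizes_def)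
qed

text \<open>Each of the four vertices trades one neighbour for another, so its balance moves only if
  the two differ in parity, and then by 2 or -2.\<close>

lemma bal_switch:
  "bal n E' u = bal n E u
    + (if u = a then chi a y - chi a b else if u = b then chi c b - chi a b
       else if u = c then chi c b - chi c y else if u = y then chi a y - chi c y else 0)"
proof -
  have sum: "(\<Sum>w\<in>insert q (S - {p}). chi u w) = (\<Sum>w\<in>S. chi u w) + chi u q - chi u p"
    if "finite S" "p \<in> S" "q \<notin> S" for S u p q
    using that by (simp add: sum.remove[of S p])
  have mem: "b \<in> nb n E a" "y \<notin> nb n E a" "a \<in> nb n E b" "c \<notin> nb n E b"
    "y \<in> nb n E c" "b \<notin> nb n E c" "c \<in> nb n E y" "a \<notin> nb n E y"
    using ab cy nay ncb reversed_pairs inV by (auto simp: nb_def)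
  consider "u = a" | "u = b" | "u = c" | "u = y" | "u \<notin> {a,b,c,y}"
    by blast
  then show ?thesis
  proof cases
    case 1
    have "bal n E' a = bal n E a + chi a y - chi a b"
      unfolding bal_def nb_switch by (rule sum) (use mem in auto)
    then show ?thesis using 1 by simp
  next
    case 2
    have "bal n E' b = bal n E b + chi b c - chi b a"
      unfolding bal_def nb_switch by (rule sum) (use mem in auto)
    then show ?thesis using 2 dist by (simp add: chi_commute[of b])
  next
    case 3
    have "bal n E' c = bal n E c + chi c b - chi c y"
      unfolding bal_def nb_switch by (rule sum) (use mem in auto)
    then show ?thesis using 3 ac cb by simp
  next
    case 4
    have "bal n E' y = bal n E y + chi y a - chi y c"
      unfolding bal_def nb_switch by (rule sum) (use mem in auto)
    then show ?thesis using 4 dist ay bny by (simp add: chi_commute[of y])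
  next
    case 5
    then show ?thesis by (simp add: bal_def nb_switch)
  qed
qed

lemma total_switch: "total n E' = total n E + 2 * (chi a y + chi c b - chi a b - chi c y)"
proof -
  define g where "g u = (if u = a then chi a y - chi a b else if u = b then chi c b - chi a b
       else if u = c then chi c b - chi c y else if u = y then chi a y - chi c y else 0)" for u
  have "total n E' = total n E + (\<Sum>u\<in>{1..n}. g u)"
    by (simp add: total_def bal_switch g_def sum.distrib)
  also have "(\<Sum>u\<in>{1..n}. g u) = (\<Sum>u\<in>{a,b,c,y}. g u)"
    by (rule sum.mono_neutral_right) (use inV in \<open>auto simp: g_def\<close>)
  also have "\<dots> = 2 * (chi a y + chi c b - chi a b - chi c y)"
    using dist ac bny ay cb by (auto simp: g_def)
  finally show ?thesis by simp
qed

end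

text \<open>The edge \<open>pq\<close>, if present, is counted on both sides and can be discarded
  from both. As \<open>v\<close> sees \<open>q\<close> but not \<open>p\<close>, and
  \<open>p\<close> has at least as many neighbours in \<open>S\<close>, some other vertex sees
  \<open>p\<close> but not \<open>q\<close>.\<close>

lemma exchange_vertex:
  assumes fin: "finite S" and sym: "\<And>u w. E u w \<Longrightarrow> E w u" and irr: "\<And>u. \<not> E u u"
    and v: "v \<in> S" "E v q" "\<not> E v p" "v \<noteq> p" and pq: "p \<in> S \<longleftrightarrow> q \<in> S"
    and le: "card {u \<in> S. E u q} \<le> card {u \<in> S. E u p}"
  obtains u where "u \<in> S" "E u p" "\<not> E u q" "u \<noteq> q" "u \<noteq> v" "u \<noteq> p"
proof -
  let ?P = "{u \<in> S. E u p}" and ?Q = "{u \<in> S. E u q}"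
  have "q \<in> ?P \<longleftrightarrow> p \<in> ?Q"
    using sym pq by auto
  then have "card (?Q - {p}) \<le> card (?P - {q})"
    using le fin by (auto simp: card_Diff_singleton_if)
  moreover have "v \<in> ?Q - {p}" "v \<notin> ?P - {q}"
    using v by auto
  ultimately have "\<not> ?P - {q} \<subseteq> ?Q - {p}"
    using fin psubset_card_mono[of "?Q - {p}" "?P - {q}"] by fastforce
  then obtain u where "u \<in> ?P - {q}" "u \<notin> ?Q - {p}"
    by blast
  then show thesis
    using that irr v by auto
qed

section \<open>The family of extremal realizations\<close>

text \<open>\<open>D\<close> is the family of extremal realizations; \<open>D_tok\<close> expresses that the balance of \<open>v\<close>
  is extremal: two units can reach \<open>v\<close> only from a larger label that they turn deficient.
  The weights \<open>\<theta>\<close> and \<open>\<kappa>\<close> rank the possible holes and pegs, with extremal elements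
  \<open>yh\<close> and \<open>xh\<close>, and are chosen differently for the two parities.\<close>

locale peg_hole =
  fixes n :: nat and d :: "nat \<Rightarrow> nat" and D :: "(nat \<Rightarrow> nat \<Rightarrow> bool) \<Rightarrow> bool"
    and v :: nat and s0 :: "nat \<Rightarrow> int" and \<theta> \<kappa> :: "nat \<Rightarrow> int" and yh xh :: nat
    and G :: "nat \<Rightarrow> nat \<Rightarrow> bool" and A B :: "nat set"
  defines "A \<equiv> {u \<in> {1..n}. even u = even v}" and "B \<equiv> {u \<in> {1..n}. even u \<noteq> even v}"
  assumes mono: "\<And>i j. 1 \<le> i \<Longrightarrow> i \<le> j \<Longrightarrow> j \<le> n \<Longrightarrow> d j \<le> d i"
    and vV: "v \<in> {1..n}"
    and D_gr: "\<And>E. D E \<Longrightarrow> realizes n d E"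
    and D_max: "\<And>E E'. D E \<Longrightarrow> realizes n d E' \<Longrightarrow> total n E' \<le> total n E"
    and D_v: "\<And>E. D E \<Longrightarrow> bal n E v \<le> -2"
    and D_s: "\<And>E u. D E \<Longrightarrow> u \<in> A \<Longrightarrow> v < u \<Longrightarrow> bal n E u = s0 u"
    and D_tok: "\<And>E E' l. D E \<Longrightarrow> realizes n d E' \<Longrightarrow> total n E' = total n E \<Longrightarrow> l \<in> A \<Longrightarrow> l \<noteq> v \<Longrightarrow>
      bal n E' v = bal n E v + 2 \<Longrightarrow> bal n E' l = bal n E l - 2 \<Longrightarrow>
      (\<And>u. u \<in> {1..n} \<Longrightarrow> u \<noteq> v \<Longrightarrow> u \<noteq> l \<Longrightarrow> bal n E' u = bal n E u) \<Longrightarrow> v < l \<and> bal n E l \<le> 0"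
    and D_same: "\<And>E E'. D E \<Longrightarrow> realizes n d E' \<Longrightarrow>
      (\<And>u. u \<in> {1..n} \<Longrightarrow> bal n E' u = bal n E u) \<Longrightarrow> D E'"
    and G: "D G" "\<not> G v yh" "yh \<in> B" "G v xh" "xh \<in> A"
    and Ymin: "\<And>E g. D E \<Longrightarrow> g \<in> B \<Longrightarrow> \<theta> yh < \<theta> g \<Longrightarrow> E v g"
    and Yvar: "\<And>E y. D E \<Longrightarrow> \<not> E v yh \<Longrightarrow> E v y \<Longrightarrow> y \<in> B \<Longrightarrow> \<theta> y \<le> \<theta> yh \<Longrightarrow>
      \<exists>u. u \<noteq> v \<and> u \<noteq> y \<and> u \<noteq> yh \<and> E u yh \<and> \<not> E u y \<and> D (switch v y u yh E)"
    and Xmin: "\<And>E x. D E \<Longrightarrow> \<not> E v yh \<Longrightarrow> E v x \<Longrightarrow> x \<in> A \<Longrightarrow> \<kappa> xh \<le> \<kappa> x"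
    and Xvar: "\<And>E x x1. D E \<Longrightarrow> \<not> E v yh \<Longrightarrow> E v x1 \<Longrightarrow> \<not> E v x \<Longrightarrow> x \<in> A \<Longrightarrow> x1 \<in> A \<Longrightarrow> x \<noteq> v \<Longrightarrow> \<kappa> x1 \<le> \<kappa> x \<Longrightarrow>
      \<exists>u. u \<noteq> v \<and> u \<noteq> x \<and> u \<noteq> x1 \<and> E u x \<and> \<not> E u x1 \<and> D (switch v x1 u x E)"
begin

text \<open>By \<open>Ymin\<close>, the holes of \<open>v\<close> in any member of \<open>D\<close>
  lie in \<open>Y\<close>, and \<open>P\<close> is joined to \<open>v\<close> in every member. By
  \<open>Xmin\<close>, the pegs of \<open>v\<close> lie in \<open>X\<close> as long as
  \<open>yh\<close> is a hole.\<close>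

definition X :: "nat set" where "X = {x \<in> A. x \<noteq> v \<and> \<kappa> xh \<le> \<kappa> x}"
definition Y :: "nat set" where "Y = {y \<in> B. \<theta> y \<le> \<theta> yh}"
definition P :: "nat set" where "P = B - Y"

lemma AB: "A \<inter> B = {}" "A \<union> B = {1..n}" "finite A" "finite B" "v \<in> A" "v \<notin> B"
  using vV by (auto simp: A_def B_def)

lemma XY: "X \<subseteq> A" "Y \<subseteq> B" "P \<subseteq> B" "v \<notin> X" "v \<notin> Y" "v \<notin> P" "finite X" "finite Y" "finite P"
  "P \<inter> Y = {}" "P \<union> Y = B"
  using AB by (auto simp: X_def Y_def P_def intro: finite_subset)

lemma chi_AA: "u \<in> A \<Longrightarrow> w \<in> A \<Longrightarrow> chi u w = -1"
  and chi_BB: "u \<in> B \<Longrightarrow> w \<in> B \<Longrightarrow> chi u w = -1"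
  and chi_AB: "u \<in> A \<Longrightarrow> w \<in> B \<Longrightarrow> chi u w = 1"
  and chi_BA: "u \<in> B \<Longrightarrow> w \<in> A \<Longrightarrow> chi u w = 1"
  by (auto simp: A_def B_def chi_def)

lemma A_B_neq: "u \<in> A \<Longrightarrow> w \<in> B \<Longrightarrow> u \<noteq> w"
  using AB by blast

lemma D_symm: "D E \<Longrightarrow> E u w \<longleftrightarrow> E w u"
  using realizes_comm D_gr by blast

lemma D_irrefl: "D E \<Longrightarrow> \<not> E u u"
  using realizes_irrefl D_gr by blast

lemma switching_D:
  assumes "D E" "E a b" "E c y" "\<not> E a y" "\<not> E c b" "a \<noteq> c" "b \<noteq> y" "a \<noteq> y" "c \<noteq> b"
  shows "switching n d E a b c y"
  using assms D_gr by (simp add: switching_def)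

lemma A_notB [simp]: "p \<in> A \<Longrightarrow> p \<notin> B"
  using AB by blast

lemma memX: "x \<in> X \<Longrightarrow> x \<in> A \<and> x \<noteq> v \<and> x \<notin> B"
  by (auto simp: X_def)

lemma memY: "y \<in> Y \<Longrightarrow> y \<in> B \<and> y \<noteq> v \<and> y \<notin> A"
  using AB by (auto simp: Y_def)

lemma memP: "y \<in> P \<Longrightarrow> y \<in> B \<and> y \<noteq> v \<and> y \<notin> A \<and> y \<notin> Y"
  using AB by (auto simp: P_def)

text \<open>The auxiliary vertex of the switch that moves the peg is unknown, so \<open>E\<close> is
  compared with \<open>G\<close> one-sidedly: edges away from \<open>v\<close> and \<open>x\<close>
  survive, and no edge appears at \<open>x\<close> except the one to \<open>v\<close>. This is what
  a further switch at \<open>v\<close> and \<open>x\<close> needs.\<close>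

definition peg_variant :: "nat \<Rightarrow> (nat \<Rightarrow> nat \<Rightarrow> bool) \<Rightarrow> bool" where
  "peg_variant x E \<longleftrightarrow> D E \<and> \<not> E v yh \<and> E v x \<and>
    (\<forall>p q. p \<noteq> v \<longrightarrow> q \<noteq> v \<longrightarrow> p \<noteq> x \<longrightarrow> q \<noteq> x \<longrightarrow> G p q \<longrightarrow> E p q) \<and>
    (\<forall>p. p \<noteq> v \<longrightarrow> E p x \<longrightarrow> G p x)"

text \<open>Pairs inside \<open>A\<close> are kept exactly, so that moving the hole does not disturb
  pegs. The last clause leaves \<open>yh\<close> a hole when \<open>y\<close> already is one; the
  exception in \<open>split_B\<close> rests on it.\<close>

definition hole_variant :: "nat \<Rightarrow> (nat \<Rightarrow> nat \<Rightarrow> bool) \<Rightarrow> (nat \<Rightarrow> nat \<Rightarrow> bool) \<Rightarrow> bool" where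
  "hole_variant y E F \<longleftrightarrow> D F \<and> \<not> F v y \<and>
    (\<forall>p. p \<noteq> v \<longrightarrow> E p y \<longrightarrow> F p y) \<and>
    (\<forall>p q. p \<noteq> v \<longrightarrow> q \<noteq> v \<longrightarrow> p \<noteq> y \<longrightarrow> q \<noteq> y \<longrightarrow> F p q \<longrightarrow> E p q) \<and>
    (\<forall>g. g \<noteq> y \<longrightarrow> g \<noteq> yh \<longrightarrow> F v g = E v g) \<and>
    (\<forall>p\<in>A. \<forall>q\<in>A. F p q = E p q) \<and>
    (\<not> E v y \<longrightarrow> F = E)"

lemma peg_variant_exists:
  assumes x: "x \<in> X"
  shows "\<exists>E. peg_variant x E"
proof (cases "G v x")
  case True
  then show ?thesis using G unfolding peg_variant_def by blast
next
  case False
  have x': "x \<in> A" "x \<noteq> v" "\<kappa> xh \<le> \<kappa> x" using x by (auto simp: X_def)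
  then obtain u where u: "u \<noteq> v" "u \<noteq> x" "u \<noteq> xh" "G u x" "\<not> G u xh" "D (switch v xh u x G)"
    using Xvar[OF G(1,2,4) False] G(5) by blast
  have "x \<noteq> yh" "xh \<noteq> x" "xh \<noteq> yh" "yh \<noteq> v" "xh \<noteq> v"
    using x' G A_B_neq AB False D_irrefl[OF G(1)] by auto
  with u have "peg_variant x (switch v xh u x G)"
    using G x' by (auto simp: switch_def doubleton_eq_iff peg_variant_def)
  then show ?thesis by blast
qed

lemma hole_variant_exists:
  assumes E: "D E" "\<not> E v yh" and y: "y \<in> Y"
  shows "\<exists>F. hole_variant y E F"
proof (cases "E v y")
  case True
  have y': "y \<in> B" "\<theta> y \<le> \<theta> yh" using y by (auto simp: Y_def)
  then obtain u where u: "u \<noteq> v" "u \<noteq> y" "u \<noteq> yh" "E u yh" "\<not> E u y" "D (switch v y u yh E)"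
    using Yvar[OF E True] by blast
  have *: "y \<noteq> yh" "y \<notin> A" "yh \<notin> A" "v \<in> A" "y \<noteq> v" "yh \<noteq> v"
    using y' G E True AB by auto
  have "hole_variant y E (switch v y u yh E)"
    unfolding hole_variant_def using * u True E by (auto simp: switch_def doubleton_eq_iff)
  then show ?thesis by blast
next
  case False
  then show ?thesis using E unfolding hole_variant_def by blast
qed

lemma peg_hole_variant_exists:
  assumes x: "x \<in> X" and y: "y \<in> Y"
  shows "\<exists>F. D F \<and> F v x \<and> \<not> F v y \<and>
    (\<forall>p. p \<noteq> v \<longrightarrow> p \<noteq> x \<longrightarrow> G p y \<longrightarrow> F p y) \<and>
    (\<forall>p. p \<noteq> v \<longrightarrow> p \<noteq> y \<longrightarrow> F p x \<longrightarrow> G p x)"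
proof -
  have *: "x \<noteq> v" "y \<noteq> v" "x \<noteq> y" "x \<in> A" using memX[OF x] memY[OF y] by auto
  obtain E where E: "peg_variant x E"
    using peg_variant_exists[OF x] by blast
  then have "D E" "\<not> E v yh" by (simp_all add: peg_variant_def)
  then obtain F where F: "hole_variant y E F"
    using hole_variant_exists[OF _ _ y] by blast
  have "F v x"
    using E F * AB(5) by (simp add: peg_variant_def hole_variant_def)
  moreover have "F p y" if "p \<noteq> v" "p \<noteq> x" "G p y" for p
  proof -
    have "E p y" using that * E by (simp add: peg_variant_def)
    then show ?thesis using that F by (simp add: hole_variant_def)
  qed
  moreover have "G p x" if "p \<noteq> v" "p \<noteq> y" "F p x" for p
  proof -
    have "E p x" using that * F unfolding hole_variant_def by blast
    then show ?thesis using that E by (simp add: peg_variant_def)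
  qed
  ultimately show ?thesis
    using F unfolding hole_variant_def by blast
qed

text \<open>If \<open>w x\<close> were missing, \<open>v\<close> could trade \<open>x\<close> for
  \<open>y\<close> while \<open>w\<close> trades \<open>y\<close> for \<open>x\<close>. Two edges
  inside the classes would become cross edges, raising the total by 8.\<close>

lemma B_complete_X:
  assumes w: "w \<in> B" and y: "y \<in> Y" and x: "x \<in> X" and wy: "G w y"
  shows "G w x"
proof (rule ccontr)
  assume "\<not> G w x"
  have *: "w \<noteq> v" "w \<noteq> x" "w \<noteq> y" "x \<noteq> y" "x \<in> A" "y \<in> B" "v \<in> A" "v \<noteq> x" "v \<noteq> y"
    using w memX[OF x] memY[OF y] wy AB(5) D_irrefl[OF G(1)] by auto
  obtain E where E: "D E" "E v x" "\<not> E v y"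
    "\<forall>p. p \<noteq> v \<longrightarrow> p \<noteq> x \<longrightarrow> G p y \<longrightarrow> E p y"
    "\<forall>p. p \<noteq> v \<longrightarrow> p \<noteq> y \<longrightarrow> E p x \<longrightarrow> G p x"
    using peg_hole_variant_exists[OF x y] by blast
  interpret switching n d E v x w y
    by (rule switching_D) (use E * wy \<open>\<not> G w x\<close> in auto)
  have "total n (switch v x w y E) = total n E + 8"
    using total_switch * w by (simp add: chi_AA chi_AB chi_BB chi_BA)
  with D_max[OF E(1) realizes_switch] show False by simp
qed

text \<open>The exchange of \<open>B_complete_X\<close>, now with \<open>l\<close> in
  \<open>A\<close>, keeps the total and carries two units of balance from \<open>l\<close> to
  \<open>v\<close>, so \<open>D_tok\<close> applies. The bound passes from the variant to
  \<open>G\<close> because balances beyond \<open>v\<close> are fixed by \<open>D_s\<close>.\<close>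

lemma token:
  assumes l: "l \<in> A" "l \<noteq> v" and y: "y \<in> Y" and x: "x \<in> X" and ly: "G l y" and lx: "\<not> G l x" "l \<noteq> x"
  shows "v < l" "bal n G l \<le> 0"
proof -
  have *: "l \<noteq> y" "x \<noteq> y" "x \<in> A" "y \<in> B" "v \<in> A" "v \<noteq> x" "v \<noteq> y"
    using l memX[OF x] memY[OF y] AB(5) by auto
  obtain E where E: "D E" "E v x" "\<not> E v y"
    "\<forall>p. p \<noteq> v \<longrightarrow> p \<noteq> x \<longrightarrow> G p y \<longrightarrow> E p y"
    "\<forall>p. p \<noteq> v \<longrightarrow> p \<noteq> y \<longrightarrow> E p x \<longrightarrow> G p x"
    using peg_hole_variant_exists[OF x y] by blast
  interpret switching n d E v x l y
    by (rule switching_D) (use E * l ly lx in auto)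
  have "v < l \<and> bal n E l \<le> 0"
  proof (rule D_tok[OF E(1) realizes_switch _ l])
    show "total n (switch v x l y E) = total n E"
      using total_switch * l by (simp add: chi_AA chi_AB)
  qed (use * l lx in \<open>auto simp: bal_switch chi_AA chi_AB\<close>)
  then show "v < l" "bal n G l \<le> 0"
    using D_s[OF E(1) l(1)] D_s[OF G(1) l(1)] by auto
qed

lemma nbr_v: "G v c \<Longrightarrow> c \<in> A \<Longrightarrow> c \<in> X"
  using Xmin[OF G(1,2)] D_irrefl[OF G(1)] by (auto simp: X_def)

lemma v_complete_P: "g \<in> P \<Longrightarrow> G v g"
  using Ymin[OF G(1)] by (force simp: P_def Y_def)

lemma no_peg:
  assumes "D E" "\<not> E v yh" "c \<in> A" "c \<noteq> v" "c \<notin> X"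
  shows "\<not> E v c"
  using Xmin[OF assms(1,2)] assms by (force simp: X_def)

text \<open>Otherwise \<open>v\<close> trades \<open>x\<close> for \<open>c\<close> and
  \<open>u\<close> trades \<open>c\<close> for \<open>x\<close>. All edges involved lie inside
  \<open>A\<close>, so no balance changes and \<open>c\<close> becomes a peg outside
  \<open>X\<close>.\<close>

lemma nbr_X:
  assumes u: "u \<in> A" "u \<noteq> v" and x: "x \<in> X" "\<not> G u x" "u \<noteq> x" and c: "c \<in> A" "c \<noteq> v" "G u c"
  shows "c \<in> X"
proof (rule ccontr)
  assume cX: "c \<notin> X"
  obtain E where "peg_variant x E"
    using peg_variant_exists[OF x(1)] by blast
  then have E: "D E" "\<not> E v yh" "E v x"
    "\<forall>p q. p \<noteq> v \<longrightarrow> q \<noteq> v \<longrightarrow> p \<noteq> x \<longrightarrow> q \<noteq> x \<longrightarrow> G p q \<longrightarrow> E p q"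
    "\<forall>p. p \<noteq> v \<longrightarrow> E p x \<longrightarrow> G p x"
    by (simp_all add: peg_variant_def)
  have *: "x \<in> A" "x \<noteq> v" "c \<noteq> x" "u \<noteq> c" "v \<in> A" "yh \<notin> A"
    using memX[OF x(1)] x cX c D_irrefl[OF G(1)] AB(5) G(3) by auto
  interpret switching n d E v x u c
    by (rule switching_D) (use E * u c x no_peg[OF E(1,2) c(1,2) cX] in auto)
  have "D (switch v x u c E)"
    by (rule D_same[OF E(1) realizes_switch]) (use * u c in \<open>auto simp: bal_switch chi_AA\<close>)
  moreover have "\<not> switch v x u c E v yh" "switch v x u c E v c"
    using * E u c G(3) AB by (auto simp: switch_def doubleton_eq_iff)
  ultimately show False
    using no_peg c cX by blast
qed

text \<open>Otherwise a switch of cross edges only, which changes no balance, would open a hole at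
  \<open>g\<close>, where no member has one.\<close>

lemma A_complete_P:
  assumes c: "c \<in> A" "c \<noteq> v" and y: "y \<in> Y" and cy: "G c y" and g: "g \<in> P"
  shows "G c g"
proof (rule ccontr)
  assume "\<not> G c g"
  have *: "y \<noteq> v" "g \<noteq> v" "y \<in> B" "g \<in> B" "v \<in> A" "g \<noteq> y" "c \<noteq> y" "c \<noteq> g"
    using c memY[OF y] memP[OF g] y AB(5) by auto
  obtain F where "hole_variant y G F"
    using hole_variant_exists[OF G(1,2) y] by blast
  then have F: "D F" "\<not> F v y"
    "\<forall>p. p \<noteq> v \<longrightarrow> G p y \<longrightarrow> F p y"
    "\<forall>p q. p \<noteq> v \<longrightarrow> q \<noteq> v \<longrightarrow> p \<noteq> y \<longrightarrow> q \<noteq> y \<longrightarrow> F p q \<longrightarrow> G p q"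
    by (simp_all add: hole_variant_def)
  have g': "\<theta> yh < \<theta> g" "F v g" using g Ymin[OF F(1)] by (force simp: P_def Y_def)+
  interpret switching n d F v g c y
    by (rule switching_D) (use F * c cy \<open>\<not> G c g\<close> g' in auto)
  have "D (switch v g c y F)"
    by (rule D_same[OF F(1) realizes_switch]) (use * c in \<open>auto simp: bal_switch chi_AB\<close>)
  then have "switch v g c y F v g"
    using Ymin g' * by blast
  then show False
    using * c by (auto simp: switch_def doubleton_eq_iff)
qed

end

text \<open>The alternating closed walk \<open>v x u v l y\<close> passes twice through
  \<open>v\<close>, so it is not a single two-edge switch. It is composed of two switches through
  the pair \<open>u y\<close>, whose state is changed and restored; that state decides their
  order.\<close>

lemma hexagon:
  assumes gr: "realizes n d F"
    and edges: "F v x" "F u v" "F l y" and nonedges: "\<not> F u x" "\<not> F v l" "\<not> F v y"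
    and neq: "v \<noteq> x" "v \<noteq> u" "v \<noteq> l" "v \<noteq> y" "x \<noteq> u" "x \<noteq> l" "x \<noteq> y" "u \<noteq> l" "u \<noteq> y" "l \<noteq> y"
  obtains F' where "realizes n d F'"
    "\<And>w. bal n F' w = bal n F w
      + (if w = v then chi v l + chi v y - chi v x - chi v u else if w = x then chi x u - chi v x
         else if w = u then chi x u - chi v u else if w = l then chi v l - chi l y
         else if w = y then chi v y - chi l y else 0)"
    "total n F' = total n F + 2 * (chi x u + chi v l + chi v y - chi v x - chi v u - chi l y)"
    "F' v y" "\<And>w. w \<notin> {x, u, l, y} \<Longrightarrow> F' v w = F v w"
proof (cases "F u y")
  case True
  have lv: "\<not> F l v" "F v u" using edges nonedges realizes_comm[OF gr] by blast+
  interpret s1: switching n d F v x u y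
    by unfold_locales (use assms True in auto)
  let ?F1 = "switch v x u y F"
  interpret s2: switching n d ?F1 u v l y
    by unfold_locales
      (use s1.realizes_switch edges nonedges neq lv in \<open>auto simp: switch_def doubleton_eq_iff\<close>)
  show thesis
  proof (rule that[of "switch u v l y ?F1"])
    show "realizes n d (switch u v l y ?F1)" by (rule s2.realizes_switch)
    show "bal n (switch u v l y ?F1) w = bal n F w
      + (if w = v then chi v l + chi v y - chi v x - chi v u else if w = x then chi x u - chi v x
         else if w = u then chi x u - chi v u else if w = l then chi v l - chi l y
         else if w = y then chi v y - chi l y else 0)" for w
      using neq by (auto simp: s2.bal_switch s1.bal_switch chi_commute)
    show "total n (switch u v l y ?F1)
      = total n F + 2 * (chi x u + chi v l + chi v y - chi v x - chi v u - chi l y)"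
      by (simp add: s2.total_switch s1.total_switch chi_commute)
  qed (use neq in \<open>auto simp: switch_def doubleton_eq_iff\<close>)
next
  case False
  have lv: "\<not> F l v" "F v u" using edges nonedges realizes_comm[OF gr] by blast+
  interpret s1: switching n d F u v l y
    by unfold_locales (use assms False lv in auto)
  let ?F1 = "switch u v l y F"
  interpret s2: switching n d ?F1 v x u y
    by unfold_locales
      (use s1.realizes_switch edges nonedges neq lv in \<open>auto simp: switch_def doubleton_eq_iff\<close>)
  show thesis
  proof (rule that[of "switch v x u y ?F1"])
    show "realizes n d (switch v x u y ?F1)" by (rule s2.realizes_switch)
    show "bal n (switch v x u y ?F1) w = bal n F w
      + (if w = v then chi v l + chi v y - chi v x - chi v u else if w = x then chi x u - chi v x
         else if w = u then chi x u - chi v u else if w = l then chi v l - chi l y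
         else if w = y then chi v y - chi l y else 0)" for w
      using neq by (auto simp: s2.bal_switch s1.bal_switch chi_commute)
    show "total n (switch v x u y ?F1)
      = total n F + 2 * (chi x u + chi v l + chi v y - chi v x - chi v u - chi l y)"
      by (simp add: s2.total_switch s1.total_switch chi_commute)
  qed (use neq in \<open>auto simp: switch_def doubleton_eq_iff\<close>)
qed

section \<open>The set R and the structure of its neighbourhoods\<close>

context peg_hole
begin

text \<open>If \<open>split_nbr\<close> holds, the vertices distinguishing \<open>v - 1\<close> from \<open>v\<close> are added to \<open>R\<close>, so that
  the pair \<open>v - 1, v\<close> has no deficit in the count; otherwise the neighbours of \<open>v\<close> in \<open>R\<close> make
  up for it.\<close>

definition R0 :: "nat set" where
  "R0 = insert v {l \<in> A. l \<noteq> v \<and> (\<exists>y\<in>Y. \<exists>x\<in>X. G l y \<and> \<not> G l x \<and> l \<noteq> x)}"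

definition split_nbr :: bool where
  "split_nbr \<longleftrightarrow> v - 1 \<in> Y \<and>
    (\<exists>u\<in>R0. \<exists>x\<in>A. G v u \<and> G v x \<and> u \<noteq> x \<and> \<not> G u x)"

definition R :: "nat set" where
  "R = (if split_nbr then R0 \<union> {l \<in> A. l \<noteq> v \<and> G l (v - 1) \<and> \<not> G l v} else R0)"

lemma R0_sub: "R0 \<subseteq> A" "R0 \<subseteq> R" "v \<in> R0"
  using AB by (auto simp: R0_def R_def)

lemma R_sub: "R \<subseteq> A" "v \<in> R" "finite R" "R \<inter> B = {}"
proof -
  show "R \<subseteq> A" using R0_sub by (auto simp: R_def)
  then show "finite R" "R \<inter> B = {}" using AB finite_subset by auto
  show "v \<in> R" using R0_sub by blast
qed

lemma split_nbrE:
  assumes split_nbr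
  obtains u x where "v - 1 \<in> Y" "u \<in> R0" "u \<in> A" "x \<in> A" "G v u" "G u v" "G v x" "u \<noteq> x" "\<not> G u x"
    "u \<noteq> v" "x \<noteq> v" "u \<in> X" "x \<in> X"
proof -
  obtain u x where "v - 1 \<in> Y" and *: "u \<in> R0" "x \<in> A" "G v u" "G v x" "u \<noteq> x" "\<not> G u x"
    using assms unfolding split_nbr_def by blast
  moreover have "u \<in> A" using * R0_sub by blast
  moreover have "G u v" using * D_symm[OF G(1)] by blast
  moreover have "u \<noteq> v" "x \<noteq> v" using * D_irrefl[OF G(1)] by auto
  moreover have "u \<in> X" "x \<in> X" using nbr_v * \<open>u \<in> A\<close> by auto
  ultimately show thesis using that by blast
qed

lemma R0_nbr:
  assumes "u \<in> R0" "c \<in> A" "c \<noteq> v" "G u c"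
  shows "c \<in> X"
proof (cases "u = v")
  case True
  then show ?thesis using nbr_v assms by blast
next
  case False
  then obtain x where "x \<in> X" "\<not> G u x" "u \<noteq> x" "u \<in> A"
    using assms(1) by (auto simp: R0_def)
  then show ?thesis using nbr_X[of u x c] False assms by blast
qed

text \<open>The hexagon lets \<open>v\<close> give up \<open>u\<close> and \<open>x\<close> for
  \<open>l\<close> and \<open>v - 1\<close>. As in \<open>token\<close>, the total is kept and two
  units pass from \<open>l\<close> to \<open>v\<close>.\<close>

lemma split_token:
  assumes sp: split_nbr and l: "l \<in> A" "l \<noteq> v" "G l (v - 1)" "\<not> G l v"
  shows "v < l \<and> bal n G l \<le> 0"
proof -
  obtain u x where ux: "v - 1 \<in> Y" "u \<in> A" "x \<in> A" "G v u" "G u v" "G v x" "u \<noteq> x" "\<not> G u x"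
    "u \<noteq> v" "x \<noteq> v"
    using split_nbrE[OF sp] by metis
  let ?y = "v - 1"
  have *: "l \<noteq> u" "l \<noteq> x" "\<not> G v l" "?y \<in> B" "?y \<noteq> v" "?y \<notin> A" "v \<in> A"
    using l ux D_symm[OF G(1)] memY[OF ux(1)] AB by auto
  then have **: "?y \<noteq> l" "?y \<noteq> u" "?y \<noteq> x" using l ux by auto
  obtain F where "hole_variant ?y G F"
    using hole_variant_exists[OF G(1,2) ux(1)] by blast
  then have F: "D F" "\<not> F v ?y" "F l ?y" "F v x" "F u v" "\<not> F u x" "\<not> F v l"
    using * ux l by (auto simp: hole_variant_def)
  obtain F' where F': "realizes n d F'"
    "\<And>w. bal n F' w = bal n F w
      + (if w = v then chi v l + chi v ?y - chi v x - chi v u else if w = x then chi x u - chi v x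
         else if w = u then chi x u - chi v u else if w = l then chi v l - chi l ?y
         else if w = ?y then chi v ?y - chi l ?y else 0)"
    "total n F' = total n F + 2 * (chi x u + chi v l + chi v ?y - chi v x - chi v u - chi l ?y)"
    by (rule hexagon[of n d F v x u l ?y]) (use F D_gr * ** ux l in auto)
  have "v < l \<and> bal n F l \<le> 0"
    by (rule D_tok[OF F(1) F'(1) _ l(1,2)]) (use * ** ux l in \<open>auto simp: F'(2,3) chi_AA chi_AB\<close>)
  then show ?thesis
    using D_s[OF F(1) l(1)] D_s[OF G(1) l(1)] by auto
qed

text \<open>A hexagon lying entirely in \<open>A\<close> changes no balance and leaves the hole
  \<open>yh\<close> alone; with \<open>c\<close> outside \<open>X\<close> it would create a
  forbidden peg.\<close>

lemma split_nbr_X: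
  assumes sp: split_nbr and l: "l \<in> A" "l \<noteq> v" "l \<notin> R0" "G l (v - 1)" "\<not> G l v"
    and c: "c \<in> A" "c \<noteq> v" "G l c"
  shows "c \<in> X"
proof (rule ccontr)
  assume cX: "c \<notin> X"
  obtain u x where ux: "u \<in> R0" "u \<in> A" "x \<in> A" "G v u" "G u v" "G v x" "u \<noteq> x" "\<not> G u x"
    "u \<noteq> v" "x \<noteq> v" "u \<in> X" "x \<in> X"
    using split_nbrE[OF sp] by metis
  have *: "l \<noteq> u" "l \<noteq> x" "\<not> G v l" "v \<in> A" "c \<noteq> u" "c \<noteq> x" "c \<noteq> l" "\<not> G v c"
    using l c cX ux D_symm[OF G(1)] D_irrefl[OF G(1)] AB no_peg[OF G(1,2) c(1,2) cX] by auto
  obtain F' where F': "realizes n d F'"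
    "\<And>w. bal n F' w = bal n G w
      + (if w = v then chi v l + chi v c - chi v x - chi v u else if w = x then chi x u - chi v x
         else if w = u then chi x u - chi v u else if w = l then chi v l - chi l c
         else if w = c then chi v c - chi l c else 0)"
    "F' v c" "\<And>w. w \<notin> {x, u, l, c} \<Longrightarrow> F' v w = G v w"
    by (rule hexagon[of n d G v x u l c]) (use G D_gr * ux l c in auto)
  have "D F'"
    by (rule D_same[OF G(1) F'(1)]) (use * ux l c in \<open>auto simp: F'(2) chi_AA\<close>)
  moreover have "\<not> F' v yh"
  proof -
    have "yh \<notin> A" using G(3) A_notB by blast
    then show ?thesis using F'(4)[of yh] G(2) ux l c by blast
  qed
  ultimately show False
    using no_peg c cX F'(3) by blast
qed

lemma R_props:
  assumes "u \<in> R" "u \<noteq> v"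
  shows "v < u" "bal n G u \<le> 0" "\<exists>y\<in>Y. G u y"
proof -
  have "v < u \<and> bal n G u \<le> 0 \<and> (\<exists>y\<in>Y. G u y)"
  proof (cases "u \<in> R0")
    case True
    then obtain y x where "u \<in> A" "y \<in> Y" "x \<in> X" "G u y" "\<not> G u x" "u \<noteq> x"
      using assms by (auto simp: R0_def)
    then show ?thesis using token[of u y x] assms by blast
  next
    case False
    then have *: split_nbr "u \<in> A" "G u (v - 1)" "\<not> G u v"
      using assms by (auto simp: R_def split: if_splits)
    then show ?thesis using split_token[of u] assms split_nbr_def by blast
  qed
  then show "v < u" "bal n G u \<le> 0" "\<exists>y\<in>Y. G u y" by blast+
qed

lemma R_nbr:
  assumes "u \<in> R" "c \<in> A" "G u c"
  shows "c = v \<or> c \<in> X"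
proof (cases "u \<in> R0")
  case True
  then show ?thesis using R0_nbr assms by blast
next
  case False
  then have "split_nbr" "u \<in> A" "G u (v - 1)" "\<not> G u v" "u \<noteq> v"
    using assms R0_sub by (auto simp: R_def split: if_splits)
  then show ?thesis using split_nbr_X False assms by blast
qed

lemma R_complete_P:
  assumes "u \<in> R" "g \<in> P"
  shows "G u g"
proof (cases "u = v")
  case True
  then show ?thesis using v_complete_P assms by blast
next
  case False
  then show ?thesis
    using R_props(3)[OF assms(1) False] A_complete_P[of u] R_sub assms by blast
qed

lemma notR_complete_X:
  assumes "l \<in> A" "l \<notin> R" "y \<in> Y" "x \<in> X" "G l y" "l \<noteq> x"
  shows "G l x"
  using assms R0_sub unfolding R0_def by blast

lemma no_split:
  assumes "\<not> split_nbr" "v - 1 \<in> Y" "u \<in> R" "G v u" "x \<in> A" "G v x" "u \<noteq> x"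
  shows "G u x"
proof -
  have "u \<in> R0" using assms(1,3) by (simp add: R_def)
  then show ?thesis using assms unfolding split_nbr_def by blast
qed

lemma split_A:
  assumes "split_nbr" "l \<in> A" "l \<notin> R" "G l (v - 1)"
  shows "G l v"
  using assms R_sub unfolding R_def by auto

text \<open>With \<open>c\<close> in \<open>B\<close> the hexagon raises the total by 8. It needs
  \<open>v c\<close> to be absent after the hole has been moved to \<open>v - 1\<close>. Moving it
  fills \<open>yh\<close>, and no move occurs if \<open>v - 1\<close> is already a hole; hence the
  only exception.\<close>

lemma split_B:
  assumes sp: split_nbr and c: "c \<in> B" "c \<noteq> v - 1" "G c (v - 1)" "\<not> G c v"
  shows "c = yh \<and> G v (v - 1)"
proof (rule ccontr)
  assume neg: "\<not> (c = yh \<and> G v (v - 1))"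
  obtain u x where ux: "v - 1 \<in> Y" "u \<in> A" "x \<in> A" "G v u" "G u v" "G v x" "u \<noteq> x" "\<not> G u x"
    "u \<noteq> v" "x \<noteq> v"
    using split_nbrE[OF sp] by metis
  let ?y = "v - 1"
  have *: "\<not> G v c" "?y \<in> B" "?y \<noteq> v" "?y \<notin> A" "v \<in> A" "v \<notin> B" "c \<notin> A"
    using c ux D_symm[OF G(1)] memY[OF ux(1)] AB by auto
  then have **: "?y \<noteq> c" "?y \<noteq> u" "?y \<noteq> x" "c \<noteq> v" "c \<noteq> u" "c \<noteq> x" using c ux by auto
  obtain F where hv: "hole_variant ?y G F"
    using hole_variant_exists[OF G(1,2) ux(1)] by blast
  then have "\<not> F v c"
    using neg * ** unfolding hole_variant_def by metis
  then have nvc: "\<not> F v c" using *(1) by simp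
  have AA: "F p q = G p q" if "p \<in> A" "q \<in> A" for p q
    using hv that by (simp add: hole_variant_def)
  have F: "D F" "\<not> F v ?y" "F c ?y"
    using hv c(3) **(4) by (simp_all add: hole_variant_def)
  have F2: "F v x" "F u v" "\<not> F u x"
    using AA[OF *(5) ux(3)] AA[OF ux(2) *(5)] AA[OF ux(2,3)] ux by simp_all
  obtain F' where F': "realizes n d F'"
    "total n F' = total n F + 2 * (chi x u + chi v c + chi v ?y - chi v x - chi v u - chi c ?y)"
    by (rule hexagon[of n d F v x u c ?y]) (use F F2 nvc D_gr * ** ux c in auto)
  have "total n F' = total n F + 8"
    using * ux c by (simp add: F'(2) chi_AA chi_AB chi_BB)
  with D_max[OF F(1) F'(1)] show False by simp
qed

end

section \<open>Counting the edges at the set R\<close>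

lemma card_filter_of_bool:
  "finite S \<Longrightarrow> int (card {x \<in> S. Q x}) = (\<Sum>x\<in>S. of_bool (Q x))"
  by (simp add: of_bool_def sum.If_cases Int_def)

context peg_hole
begin

definition cnt :: "nat set \<Rightarrow> nat \<Rightarrow> int" where
  "cnt S u = (\<Sum>w\<in>S. of_bool (G u w))"

definition f :: "nat \<Rightarrow> int" where "f c = cnt R c"

definition m :: int where "m = int (card R)"

text \<open>The contribution of the pair \<open>b, b + 1\<close> to the sum of balances over
  \<open>R\<close>: cross edges counted at \<open>b\<close>, minus edges inside \<open>A\<close>
  counted at \<open>b + 1\<close>. On \<open>P\<close>, \<open>f b\<close> equals \<open>m\<close>;
  writing \<open>m\<close> shows the value as a number of non-neighbours in
  \<open>R\<close>.\<close>

definition \<phi> :: "nat \<Rightarrow> int" where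
  "\<phi> b = (if b \<in> P then m else f b) - (if Suc b \<in> insert v X then f (Suc b) else 0)"

definition Bneg :: "nat \<Rightarrow> nat set" where
  "Bneg b = {c \<in> B. c \<noteq> b \<and> G c (Suc b) \<and> \<not> G c b}"

definition Aneg :: "nat \<Rightarrow> nat set" where
  "Aneg b = {l \<in> A. l \<notin> R \<and> l \<noteq> Suc b \<and> G l (Suc b) \<and> \<not> G l b}"

lemma G_symm: "G u w \<longleftrightarrow> G w u"
  using D_symm[OF G(1)] .

lemma G_irrefl [simp]: "\<not> G u u"
  using D_irrefl[OF G(1)] .

lemma cnt_card: "finite S \<Longrightarrow> cnt S u = int (card {w \<in> S. G u w})"
  by (simp add: cnt_def card_filter_of_bool)

lemma cnt_mono: "finite T \<Longrightarrow> S \<subseteq> T \<Longrightarrow> cnt S u \<le> cnt T u"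
  unfolding cnt_def by (rule sum_mono2) auto

lemma cnt_le_card: "cnt S u \<le> int (card S)"
  using sum_mono[of S "\<lambda>w. of_bool (G u w)" "\<lambda>_. 1::int"] by (simp add: cnt_def)

lemma cnt_nonneg: "0 \<le> cnt S u"
  unfolding cnt_def by (rule sum_nonneg) auto

lemma cnt_full: "(\<And>w. w \<in> S \<Longrightarrow> G u w) \<Longrightarrow> cnt S u = int (card S)"
  by (simp add: cnt_def)

lemma cnt_Un: "finite S \<Longrightarrow> finite T \<Longrightarrow> S \<inter> T = {} \<Longrightarrow> cnt (S \<union> T) u = cnt S u + cnt T u"
  unfolding cnt_def by (rule sum.union_disjoint)

lemma cnt_V: "u \<in> {1..n} \<Longrightarrow> int (d u) = cnt A u + cnt B u"
proof -
  assume "u \<in> {1..n}"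
  then have "int (d u) = cnt {1..n} u"
    using realizes_card[OF D_gr[OF G(1)]] by (simp add: nb_def cnt_card)
  then show ?thesis
    using cnt_Un[of A B u] AB by simp
qed

lemma bal_cnt: "u \<in> A \<Longrightarrow> bal n G u = cnt B u - cnt A u"
proof -
  assume u: "u \<in> A"
  have "bal n G u = (\<Sum>w\<in>{1..n}. if G u w then chi u w else 0)"
    unfolding bal_def nb_def by (rule sum.inter_filter) simp
  also have "\<dots> = (\<Sum>w\<in>A. if G u w then chi u w else 0) + (\<Sum>w\<in>B. if G u w then chi u w else 0)"
    using sum.union_disjoint[OF AB(3,4,1)] AB(2) by simp
  also have "(\<Sum>w\<in>A. if G u w then chi u w else 0) = - cnt A u"
    unfolding cnt_def sum_negf[symmetric] by (rule sum.cong) (use u in \<open>auto simp: chi_AA\<close>)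
  also have "(\<Sum>w\<in>B. if G u w then chi u w else 0) = cnt B u"
    unfolding cnt_def by (rule sum.cong) (use u in \<open>auto simp: chi_AB\<close>)
  finally show ?thesis by simp
qed

lemma f_nonneg: "0 \<le> f c"
  unfolding f_def by (rule cnt_nonneg)

lemma f_P: "g \<in> P \<Longrightarrow> f g = m"
  unfolding f_def m_def by (rule cnt_full) (use R_complete_P G_symm in blast)

lemma sum_cnt_swap: "(\<Sum>u\<in>R. cnt S u) = (\<Sum>c\<in>S. f c)"
  unfolding cnt_def f_def by (subst sum.swap) (simp add: G_symm)

lemma cnt_A_R: "u \<in> R \<Longrightarrow> cnt A u = cnt (insert v X) u"
  unfolding cnt_def
  by (rule sum.mono_neutral_right) (use AB(3,5) XY(1) in \<open>auto dest: R_nbr\<close>)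

lemma Suc_in: "b \<in> B \<Longrightarrow> Suc b \<in> insert v X \<Longrightarrow> Suc b \<in> A \<and> 1 \<le> b \<and> Suc b \<le> n"
  using AB XY by (auto simp: A_def B_def)

lemma insert_vX: "insert v X = Suc ` {b \<in> B. Suc b \<in> insert v X} \<union> (insert v X \<inter> {1})"
proof -
  have "x \<in> Suc ` {b \<in> B. Suc b \<in> insert v X}" if "x \<in> insert v X" "x \<noteq> 1" for x
  proof -
    have "x \<in> A" using that AB XY by auto
    then have "x - 1 \<in> B" "Suc (x - 1) = x"
      using that(2) by (auto simp: A_def B_def)
    then show ?thesis using that(1) by (metis (no_types, lifting) image_eqI mem_Collect_eq)
  qed
  then show ?thesis by blast
qed

text \<open>Double counting: cross edges at \<open>R\<close> are counted from \<open>B\<close>,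
  edges inside \<open>A\<close> from \<open>insert v X\<close>, which contains all neighbours of
  \<open>R\<close> in \<open>A\<close>. Shifting the second sum by one aligns it with the first;
  only label 1 has no partner.\<close>

lemma sum_bal: "(\<Sum>u\<in>R. bal n G u) = (\<Sum>b\<in>B. \<phi> b) - (if 1 \<in> insert v X then f 1 else 0)"
proof -
  have "(\<Sum>u\<in>R. bal n G u) = (\<Sum>u\<in>R. cnt B u - cnt (insert v X) u)"
    by (rule sum.cong) (use R_sub bal_cnt cnt_A_R in auto)
  also have "\<dots> = (\<Sum>b\<in>B. f b) - (\<Sum>x\<in>insert v X. f x)"
    by (simp add: sum_subtractf sum_cnt_swap del: insert_iff)
  also have "(\<Sum>b\<in>B. f b) = (\<Sum>b\<in>B. if b \<in> P then m else f b)"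
    by (rule sum.cong) (auto simp: f_P)
  also have "(\<Sum>x\<in>insert v X. f x)
      = (\<Sum>x\<in>Suc ` {b \<in> B. Suc b \<in> insert v X}. f x) + (\<Sum>x\<in>insert v X \<inter> {1}. f x)"
    by (subst insert_vX, rule sum.union_disjoint) (use AB XY in \<open>auto simp: B_def\<close>)
  also have "(\<Sum>x\<in>Suc ` {b \<in> B. Suc b \<in> insert v X}. f x)
      = (\<Sum>b\<in>{b \<in> B. Suc b \<in> insert v X}. f (Suc b))"
    by (subst sum.reindex) (auto simp del: insert_iff)
  also have "\<dots> = (\<Sum>b\<in>B. if Suc b \<in> insert v X then f (Suc b) else 0)"
    by (rule sum.inter_filter) (use AB in simp)
  also have "(\<Sum>x\<in>insert v X \<inter> {1}. f x) = (if 1 \<in> insert v X then f 1 else 0)"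
    by (simp add: Int_insert_right)
  finally show ?thesis
    by (simp add: \<phi>_def sum_subtractf del: insert_iff)
qed

lemma pair_degrees:
  assumes "b \<in> B" "Suc b \<in> insert v X"
  shows "0 \<le> (f b - f (Suc b)) + (\<Sum>c\<in>A - R. of_bool (G c b) - of_bool (G c (Suc b)))
    + (\<Sum>c\<in>B. of_bool (G c b) - of_bool (G c (Suc b)))"
proof -
  have n: "1 \<le> b" "Suc b \<le> n" using Suc_in[OF assms] by auto
  have split: "int (d c) = f c + cnt (A - R) c + cnt B c" if "c \<in> {1..n}" for c
    using cnt_V[OF that] cnt_Un[of R "A - R" c] AB(3) R_sub by (simp add: f_def Un_absorb1)
  have "int (d (Suc b)) \<le> int (d b)" using mono n by simp
  then show ?thesis
    using split[of b] split[of "Suc b"] n by (simp add: cnt_def sum_subtractf G_symm)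
qed

text \<open>Apart from the pair itself, every neighbour of \<open>b\<close> outside \<open>R\<close>
  also sees \<open>Suc b\<close>. Since the degree of \<open>b\<close> is no smaller, each vertex
  outside \<open>R\<close> seen by \<open>Suc b\<close> alone forces an excess of \<open>b\<close>
  inside \<open>R\<close>. The edge \<open>b, Suc b\<close> counts on both sides unless
  \<open>Suc b\<close> is in \<open>R\<close>, where it is one more unit.\<close>

lemma pair_slack:
  assumes b: "b \<in> Y" and x: "Suc b \<in> X"
  shows "int (card (Bneg b)) + int (card (Aneg b)) + of_bool (Suc b \<in> R \<and> G b (Suc b)) \<le> \<phi> b"
proof -
  let ?x = "Suc b"
  have bB: "b \<in> B" "b \<notin> P" "?x \<in> A" using memY[OF b] b memX[OF x] by (auto simp: P_def)
  have "(\<Sum>c\<in>B. of_bool (G c b) - of_bool (G c ?x))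
      \<le> (\<Sum>c\<in>B. - of_bool (c \<noteq> b \<and> G c ?x \<and> \<not> G c b) - (if c = b then of_bool (G b ?x) else 0) :: int)"
    by (rule sum_mono) (use B_complete_X[OF _ b x] in auto)
  also have "\<dots> = - int (card (Bneg b)) - of_bool (G b ?x)"
    using AB(4) bB by (simp add: sum_subtractf sum_negf Bneg_def card_filter_of_bool)
  finally have 1: "(\<Sum>c\<in>B. of_bool (G c b) - of_bool (G c ?x)) \<le> - int (card (Bneg b)) - of_bool (G b ?x)" .
  have "(\<Sum>c\<in>A - R. of_bool (G c b) - of_bool (G c ?x))
      \<le> (\<Sum>c\<in>A - R. - of_bool (c \<noteq> ?x \<and> G c ?x \<and> \<not> G c b) + (if c = ?x then of_bool (G b ?x) else 0) :: int)"
    by (rule sum_mono) (use notR_complete_X[OF _ _ b x] G_symm in auto)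
  also have "\<dots> = - int (card (Aneg b)) + of_bool (?x \<notin> R \<and> G b ?x)"
  proof -
    have "Aneg b = {c \<in> A - R. c \<noteq> ?x \<and> G c ?x \<and> \<not> G c b}" by (auto simp: Aneg_def)
    then have "int (card (Aneg b)) = (\<Sum>c\<in>A - R. of_bool (c \<noteq> ?x \<and> G c ?x \<and> \<not> G c b))"
      using card_filter_of_bool[of "A - R"] AB(3) by simp
    then show ?thesis
      using AB(3) bB by (simp add: sum.distrib sum_negf sum_subtractf del: sum_of_bool_eq)
  qed
  finally have 2: "(\<Sum>c\<in>A - R. of_bool (G c b) - of_bool (G c ?x))
      \<le> - int (card (Aneg b)) + of_bool (?x \<notin> R \<and> G b ?x)" .
  have "\<phi> b = f b - f ?x" using bB x by (simp add: \<phi>_def)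
  with pair_degrees[OF bB(1)] x 1 2 show ?thesis
    by (cases "?x \<in> R"; cases "G b ?x") auto
qed

lemma pair_v:
  assumes sp: split_nbr and v: "2 \<le> v"
  shows "f v \<le> f (v - 1)"
proof -
  let ?y = "v - 1"
  have y: "?y \<in> Y" using sp by (simp add: split_nbr_def)
  have Sv: "Suc ?y = v" using v by simp
  have yB: "?y \<in> B" using memY[OF y] by simp
  \<comment> \<open>The exceptional \<open>yh\<close> can contribute 1 only when \<open>v\<close>
    and \<open>v - 1\<close> are adjacent, and then \<open>c = v - 1\<close> contributes -1.\<close>
  have "(\<Sum>c\<in>B. of_bool (G c ?y) - of_bool (G c v))
      \<le> (\<Sum>c\<in>B. (if c = yh then of_bool (G v ?y) else 0) - (if c = ?y then of_bool (G v ?y) else 0) :: int)"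
  proof (rule sum_mono)
    fix c assume c: "c \<in> B"
    show "of_bool (G c ?y) - of_bool (G c v)
      \<le> ((if c = yh then of_bool (G v ?y) else 0) - (if c = ?y then of_bool (G v ?y) else 0) :: int)"
    proof (cases "c = ?y")
      case True
      then show ?thesis using G_symm[of c v] by simp
    next
      case False
      show ?thesis
      proof (cases "G c ?y \<and> \<not> G c v")
        case True
        then have "c = yh" "G v ?y" using split_B[OF sp c False] by auto
        then show ?thesis using False by simp
      next
        case False': False
        then have "of_bool (G c ?y) - of_bool (G c v) \<le> (0::int)" by auto
        moreover have "0 \<le> ((if c = yh then of_bool (G v ?y) else 0) - (if c = ?y then of_bool (G v ?y) else 0) :: int)"
          using False by simp
        ultimately show ?thesis by (rule order_trans)
      qed
    qed
  qed
  also have "\<dots> = 0"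
    using AB(4) G(3) yB by (simp add: sum_subtractf)
  finally have 1: "(\<Sum>c\<in>B. of_bool (G c ?y) - of_bool (G c v)) \<le> (0::int)" .
  have 2: "(\<Sum>c\<in>A - R. of_bool (G c ?y) - of_bool (G c v)) \<le> (0::int)"
    by (rule sum_nonpos) (use split_A[OF sp] in auto)
  from pair_degrees[OF yB] Sv 1 2 show ?thesis
    by simp
qed

lemma m_minus_f: "m - f h = int (card {u \<in> R. \<not> G u h})"
proof -
  have "card R = card ({u \<in> R. G u h} \<union> {u \<in> R. \<not> G u h})"
    by (rule arg_cong[of _ _ card]) auto
  also have "\<dots> = card {u \<in> R. G u h} + card {u \<in> R. \<not> G u h}"
    by (rule card_Un_disjoint) (use R_sub(3) in auto)
  finally show ?thesis
    using cnt_card[OF R_sub(3), of h] by (simp add: m_def f_def G_symm)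
qed

lemma \<phi>_P:
  assumes "b \<in> P" "Suc b \<in> insert v X"
  shows "\<phi> b = int (card {u \<in> R. \<not> G u (Suc b)})"
  using assms m_minus_f[of "Suc b"] by (simp add: \<phi>_def)

lemma m_pos: "1 \<le> m"
  using R_sub by (auto simp: m_def card_gt_0_iff Suc_le_eq)

lemma \<phi>_P_nonneg: "b \<in> P \<Longrightarrow> 0 \<le> \<phi> b"
  using \<phi>_P[of b] by (cases "Suc b \<in> insert v X") (auto simp: \<phi>_def m_def)

text \<open>There are no loops, so \<open>Suc b\<close> itself is a member of \<open>R\<close> not
  adjacent to \<open>Suc b\<close>.\<close>

lemma \<phi>_P_pos:
  assumes "b \<in> P" "Suc b \<in> R"
  shows "1 \<le> \<phi> b"
proof (cases "Suc b \<in> insert v X")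
  case True
  have "Suc b \<in> {u \<in> R. \<not> G u (Suc b)}" using assms by simp
  then have "0 < card {u \<in> R. \<not> G u (Suc b)}"
    using R_sub(3) card_gt_0_iff by fastforce
  then show ?thesis using \<phi>_P[OF assms(1) True] by simp
next
  case False
  have "0 < card R" using R_sub by (auto simp: card_gt_0_iff)
  then show ?thesis using False assms by (simp add: \<phi>_def m_def)
qed

lemma \<phi>_Y_free: "b \<in> Y \<Longrightarrow> Suc b \<notin> insert v X \<Longrightarrow> \<phi> b = f b"
  by (auto simp: \<phi>_def P_def)

lemma \<phi>_nonneg:
  assumes "b \<in> B" "Suc b = v \<Longrightarrow> b \<in> Y \<Longrightarrow> split_nbr"
  shows "0 \<le> \<phi> b"
proof (cases "b \<in> P")
  case True
  then show ?thesis by (rule \<phi>_P_nonneg)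
next
  case False
  then have b: "b \<in> Y" using assms(1) by (simp add: P_def)
  consider "Suc b = v" | "Suc b \<in> X" | "Suc b \<notin> insert v X" by blast
  then show ?thesis
  proof cases
    case 1
    have "1 \<le> b" using assms(1) by (auto simp: B_def)
    then have "f v \<le> f (v - 1)" "v - 1 = b" using pair_v assms 1 b by auto
    then show ?thesis using False 1 by (simp add: \<phi>_def)
  next
    case 2
    have "0 \<le> int (card (Bneg b)) + int (card (Aneg b)) + of_bool (Suc b \<in> R \<and> G b (Suc b))"
      by simp
    then show ?thesis using pair_slack[OF b 2] by (rule order_trans)
  next
    case 3
    then show ?thesis using \<phi>_Y_free[OF b] f_nonneg by simp
  qed
qed

lemma cnt_A_v: "cnt A v = cnt X v"
  unfolding cnt_def
  by (rule sum.mono_neutral_right) (use AB(3) XY(1) in \<open>auto dest: nbr_v\<close>)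

lemma cnt_P_v: "cnt P v = int (card P)"
  by (rule cnt_full) (rule v_complete_P)

lemma cnt_B_split: "cnt B c = cnt P c + cnt Y c"
  using cnt_Un[of P Y c] XY by simp

text \<open>If \<open>b\<close> has a neighbour in \<open>Y\<close>, it sees all of
  \<open>X\<close>, at least as much of \<open>A\<close> as \<open>v\<close> does, and its degree is
  no larger. Otherwise its neighbours in \<open>B\<close> lie in \<open>P\<close>, which
  \<open>v\<close> sees completely.\<close>

lemma cnt_B_later:
  assumes b: "b \<in> B" "v \<le> b"
  shows "cnt B b \<le> cnt B v"
proof (cases "\<exists>y\<in>Y. G b y")
  case True
  then have "cnt X b = int (card X)"
    using B_complete_X[OF b(1)] by (intro cnt_full) blast
  moreover have "cnt X b \<le> cnt A b" using AB XY by (intro cnt_mono) auto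
  moreover have "int (d b) \<le> int (d v)" using mono[of v b] b vV by (simp add: B_def)
  moreover have "cnt A v \<le> int (card X)" using cnt_A_v cnt_le_card by simp
  ultimately show ?thesis
    using cnt_V[of b] cnt_V[OF vV] b by (simp add: B_def)
next
  case False
  then have "cnt Y b = 0" by (auto simp: cnt_def intro!: sum.neutral)
  then show ?thesis
    using cnt_B_split[of b] cnt_B_split[of v] cnt_P_v cnt_le_card[of P b] cnt_nonneg[of Y v] by simp
qed

text \<open>Without a split pair, \<open>u\<close> sees every other neighbour of \<open>v\<close> in
  \<open>A\<close>, with \<open>v\<close> in place of \<open>u\<close> itself. Its balance exceeds
  that of \<open>v\<close> by at least 2, so it has two more neighbours in \<open>B\<close> than
  \<open>v\<close>, hence than \<open>b\<close>.\<close>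

lemma two_units:
  assumes nsp: "\<not> split_nbr" "v - 1 \<in> Y" and u: "u \<in> R" "G v u" "0 \<le> bal n G u"
    and b: "u = Suc b" "b \<in> Y"
  shows "2 \<le> int (card (Bneg b)) + of_bool (G b u)"
proof -
  have uv: "u \<noteq> v" "u \<in> A" "v < u"
  proof -
    show "u \<noteq> v" using u(2) by auto
    then show "u \<in> A" "v < u" using u(1) R_sub(1) R_props(1)[OF u(1)] by auto
  qed
  have bB: "b \<in> B" using memY[OF b(2)] by simp
  have vb: "v \<le> b" using uv b by simp
  have "insert v ({x \<in> A. G v x} - {u}) \<subseteq> {x \<in> A. G u x}"
    using no_split[OF nsp u(1,2)] u(2) G_symm AB(5) by auto
  then have "card (insert v ({x \<in> A. G v x} - {u})) \<le> card {x \<in> A. G u x}"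
    using AB(3) by (intro card_mono) auto
  moreover have "card (insert v ({x \<in> A. G v x} - {u})) = card {x \<in> A. G v x}"
  proof -
    have "u \<in> {x \<in> A. G v x}" "v \<notin> {x \<in> A. G v x} - {u}" using u(2) uv by auto
    then show ?thesis
      using AB(3) card.remove[of "{x \<in> A. G v x}" u] by simp
  qed
  ultimately have "cnt A v \<le> cnt A u" using AB(3) by (simp add: cnt_card)
  then have big: "cnt B v + 2 \<le> cnt B u"
    using bal_cnt[OF uv(2)] bal_cnt[OF AB(5)] u(3) D_v[OF G(1)] by simp
  have "{c \<in> B. G u c} \<subseteq> (Bneg b \<union> {c \<in> B. G b c}) \<union> {c. c = b \<and> G b u}"
    using b G_symm by (auto simp: Bneg_def)
  then have "card {c \<in> B. G u c} \<le> card ((Bneg b \<union> {c \<in> B. G b c}) \<union> {c. c = b \<and> G b u})"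
    by (rule card_mono[rotated]) (use AB(4) in \<open>auto simp: Bneg_def\<close>)
  also have "\<dots> \<le> card (Bneg b) + card {c \<in> B. G b c} + card {c. c = b \<and> G b u}"
    by (meson add_mono card_Un_le le_trans order_refl)
  also have "card {c. c = b \<and> G b u} = of_bool (G b u)" by simp
  finally have "int (card {c \<in> B. G u c})
      \<le> int (card (Bneg b) + card {c \<in> B. G b c} + of_bool (G b u))"
    by (rule of_nat_mono)
  then have "cnt B u \<le> int (card (Bneg b)) + cnt B b + of_bool (G b u)"
    using cnt_card[OF AB(4), of u] cnt_card[OF AB(4), of b] by (simp only: of_nat_add of_nat_of_bool)
  then show ?thesis using big cnt_B_later[OF bB vb] by simp
qed

text \<open>\<open>N\<close> will consist of the neighbours of \<open>v\<close> in \<open>R\<close>.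
  Each deficient one lowers the sum further, which offsets its share in the deficit of the pair
  \<open>v - 1, v\<close>.\<close>

lemma sum_bal_le:
  assumes "N \<subseteq> R - {v}"
  shows "(\<Sum>u\<in>R. bal n G u) \<le> -2 - int (card {u \<in> N. bal n G u < 0})"
proof -
  have "(\<Sum>u\<in>R. bal n G u) = bal n G v + (\<Sum>u\<in>R - {v}. bal n G u)"
    using R_sub by (simp add: sum.remove)
  also have "(\<Sum>u\<in>R - {v}. bal n G u) \<le> (\<Sum>u\<in>R - {v}. - of_bool (u \<in> N \<and> bal n G u < 0))"
    by (rule sum_mono) (use R_props(2) in auto)
  also have "\<dots> = - int (card {u \<in> R - {v}. u \<in> N \<and> bal n G u < 0})"
    using R_sub(3) card_filter_of_bool[of "R - {v}" "\<lambda>u. u \<in> N \<and> bal n G u < 0"]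
    by (simp add: sum_negf del: sum_of_bool_eq)
  also have "{u \<in> R - {v}. u \<in> N \<and> bal n G u < 0} = {u \<in> N. bal n G u < 0}"
    using assms by auto
  finally show ?thesis using D_v[OF G(1)] by simp
qed

text \<open>Every label of \<open>A\<close> has a predecessor, so no boundary term arises. Only
  \<open>\<phi> (v - 1)\<close> can be negative, by at most the number of neighbours of
  \<open>v\<close> in \<open>R\<close>. Such a neighbour \<open>u\<close> is repaid by
  \<open>\<phi> (u - 1)\<close> if its balance is nonnegative, and by \<open>sum_bal_le\<close>
  otherwise.\<close>

lemma no_hole_if_even:
  assumes "1 \<notin> A"
  shows False
proof -
  have v2: "v \<noteq> 1" "1 \<notin> insert v X" using assms AB XY by auto
  then have sum: "(\<Sum>u\<in>R. bal n G u) = (\<Sum>b\<in>B. \<phi> b)" using sum_bal by simp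
  show False
  proof (cases "v - 1 \<in> Y \<longrightarrow> split_nbr")
    case True
    then have "0 \<le> (\<Sum>b\<in>B. \<phi> b)"
      by (intro sum_nonneg \<phi>_nonneg) auto
    then show False using sum sum_bal_le[of "{}"] by simp
  next
    case False
    then have y: "v - 1 \<in> Y" "\<not> split_nbr" by auto
    define N where "N = {u \<in> R. G v u}"
    have N: "N \<subseteq> R - {v}" "finite N" using R_sub by (auto simp: N_def)
    let ?N0 = "{u \<in> N. 0 \<le> bal n G u}"
    have "v - 1 \<in> B" using memY[OF y(1)] by simp
    have Suc_v: "Suc (v - 1) = v" using vV v2 by auto
    have NB: "u - 1 \<in> B - {v - 1}" "Suc (u - 1) = u" if "u \<in> N" for u
    proof -
      have "u \<in> A" "v < u" using that N R_props(1) R_sub by blast+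
      then show "u - 1 \<in> B - {v - 1}" "Suc (u - 1) = u"
        using vV by (auto simp: A_def B_def)
    qed
    have one: "1 \<le> \<phi> (u - 1)" if u: "u \<in> ?N0" for u
    proof (cases "u - 1 \<in> P")
      case True
      then show ?thesis using \<phi>_P_pos NB u N by auto
    next
      case False
      have uN: "u \<in> N" using u by simp
      then have b: "u - 1 \<in> Y" "u = Suc (u - 1)" using False NB[OF uN] by (auto simp: P_def)
      have "u \<in> X" using uN nbr_v R_sub by (auto simp: N_def)
      then have X: "Suc (u - 1) \<in> X" using b by simp
      have "2 \<le> int (card (Bneg (u - 1))) + of_bool (G (u - 1) u)"
        by (rule two_units[OF y(2,1) _ _ _ b(2,1)]) (use u in \<open>auto simp: N_def\<close>)
      then show ?thesis using pair_slack[OF b(1) X] b(2)[symmetric] uN by (simp add: N_def)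
    qed
    have inj: "inj_on (\<lambda>u. u - 1) ?N0"
      by (rule inj_onI) (metis NB(2) mem_Collect_eq)
    have "int (card ?N0) \<le> (\<Sum>u\<in>?N0. \<phi> (u - 1))"
      using sum_mono[of ?N0 "\<lambda>_. 1" "\<lambda>u. \<phi> (u - 1)"] one by simp
    also have "\<dots> = (\<Sum>b\<in>(\<lambda>u. u - 1) ` ?N0. \<phi> b)"
      by (subst sum.reindex[OF inj]) simp
    also have "\<dots> \<le> (\<Sum>b\<in>B - {v - 1}. \<phi> b)"
      by (rule sum_mono2) (use NB AB(4) Suc_v in \<open>auto intro!: \<phi>_nonneg\<close>)
    finally have 1: "int (card ?N0) \<le> (\<Sum>b\<in>B - {v - 1}. \<phi> b)" .
    have "\<phi> (v - 1) = f (v - 1) - f v" using y Suc_v by (simp add: \<phi>_def P_def)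
    moreover have "f v = int (card N)" using R_sub(3) by (simp add: f_def cnt_card N_def)
    ultimately have 2: "- int (card N) \<le> \<phi> (v - 1)" using f_nonneg[of "v - 1"] by simp
    have "card N = card (?N0 \<union> {u \<in> N. bal n G u < 0})" by (rule arg_cong[of _ _ card]) auto
    also have "\<dots> = card ?N0 + card {u \<in> N. bal n G u < 0}"
      by (rule card_Un_disjoint) (use N in auto)
    finally have 3: "card N = card ?N0 + card {u \<in> N. bal n G u < 0}" .
    have "(\<Sum>b\<in>B. \<phi> b) = \<phi> (v - 1) + (\<Sum>b\<in>B - {v - 1}. \<phi> b)"
      using AB(4) \<open>v - 1 \<in> B\<close> by (simp add: sum.remove)
    with 1 2 3 sum sum_bal_le[OF N(1)] show False by simp
  qed
qed

end

section \<open>Odd labels\<close>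

text \<open>Ranking holes by label makes \<open>P\<close> an initial and \<open>Y\<close> a final
  segment of the even labels. \<open>D_sameA\<close> expresses that balances in \<open>B\<close> are
  free; \<open>earlier_nbr\<close> controls neighbours before \<open>v\<close> in the degree count
  of \<open>zero_class\<close>.\<close>

locale odd_peg_hole = peg_hole +
  assumes odd_v: "odd v"
    and theta: "\<And>y. \<theta> y = - int y"
    and D_sameA: "\<And>E E'. D E \<Longrightarrow> realizes n d E' \<Longrightarrow> total n E' = total n E \<Longrightarrow>
      (\<And>u. u \<in> A \<Longrightarrow> bal n E' u = bal n E u) \<Longrightarrow> D E'"
    and earlier_nbr: "\<And>c w. c \<in> A \<Longrightarrow> c \<notin> X \<Longrightarrow> c < v \<Longrightarrow> w \<in> B \<Longrightarrow> G w c \<Longrightarrow>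
      \<exists>x\<in>X. x - 1 \<in> Y \<and> G w x"
begin

lemma A_odd: "A = {u \<in> {1..n}. odd u}" "B = {u \<in> {1..n}. even u}"
  using odd_v by (auto simp: A_def B_def)

lemma Y_label: "Y = {y \<in> B. yh \<le> y}"
  by (auto simp: Y_def theta)

text \<open>The switch keeps the total and shifts balance only from \<open>g\<close> to
  \<open>y\<close>, both in \<open>B\<close>. The family tolerates this, so \<open>g\<close> would
  become a hole.\<close>

lemma B_complete_P:
  assumes c: "c \<in> B" and y: "y \<in> Y" and cy: "G c y" and g: "g \<in> P" "c \<noteq> g"
  shows "G c g"
proof (rule ccontr)
  assume "\<not> G c g"
  have *: "y \<noteq> v" "g \<noteq> v" "y \<in> B" "g \<in> B" "v \<in> A" "g \<noteq> y" "c \<noteq> y" "c \<noteq> v"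
    "y \<notin> A" "g \<notin> A" "c \<notin> A"
    using c cy memY[OF y] memP[OF g(1)] y AB(5) by auto
  obtain F where "hole_variant y G F"
    using hole_variant_exists[OF G(1,2) y] by blast
  then have F: "D F" "\<not> F v y"
    "\<forall>p. p \<noteq> v \<longrightarrow> G p y \<longrightarrow> F p y"
    "\<forall>p q. p \<noteq> v \<longrightarrow> q \<noteq> v \<longrightarrow> p \<noteq> y \<longrightarrow> q \<noteq> y \<longrightarrow> F p q \<longrightarrow> G p q"
    by (simp_all add: hole_variant_def)
  have g': "\<theta> yh < \<theta> g" "F v g" using g Ymin[OF F(1)] by (force simp: P_def Y_def)+
  interpret switching n d F v g c y
    by (rule switching_D) (use F * c cy \<open>\<not> G c g\<close> g g' in auto)
  have "D (switch v g c y F)"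
  proof (rule D_sameA[OF F(1) realizes_switch])
    show "total n (switch v g c y F) = total n F"
      using total_switch * c by (simp add: chi_AB chi_BB)
    show "bal n (switch v g c y F) u = bal n F u" if "u \<in> A" for u
      using * c that by (auto simp: bal_switch chi_AB)
  qed
  then have "switch v g c y F v g"
    using Ymin g' * by blast
  then show False
    using * g by (auto simp: switch_def doubleton_eq_iff)
qed

text \<open>Apart from a possible \<open>v - 1\<close>, the set \<open>Y\<close> splits into
  \<open>Y1\<close>, whose pairs have both terms, and \<open>Y0\<close>, where nothing is
  subtracted. \<open>X0\<close> collects the pegs whose partner is in \<open>P\<close>, and label 1,
  which has none.\<close>

definition Y1 :: "nat set" where "Y1 = {b \<in> Y. Suc b \<in> X}"
definition Y0 :: "nat set" where "Y0 = {b \<in> Y. Suc b \<notin> insert v X}"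
definition X0 :: "nat set" where "X0 = {x \<in> X. x - 1 \<notin> Y}"

lemma Y01: "Y0 \<subseteq> Y" "Y1 \<subseteq> Y" "Y0 \<inter> Y1 = {}" "finite Y0" "finite Y1" "finite X0" "X0 \<subseteq> X"
  using XY(7,8) by (auto simp: Y0_def Y1_def X0_def)

lemma X_pred: "x \<in> X \<Longrightarrow> x \<noteq> 1 \<Longrightarrow> x - 1 \<in> B \<and> Suc (x - 1) = x"
  using memX[of x] by (auto simp: A_odd)

lemma X1: "X = X0 \<union> Suc ` Y1" "X0 \<inter> Suc ` Y1 = {}"
proof -
  have "x \<in> Suc ` Y1" if "x \<in> X" "x - 1 \<in> Y" for x
  proof -
    have "x \<noteq> 1" using that memY[of 0] by (auto simp: B_def)
    then have "Suc (x - 1) = x" using X_pred that by blast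
    then have "x - 1 \<in> Y1" "x = Suc (x - 1)" using that by (simp_all add: Y1_def)
    then show ?thesis by (rule rev_image_eqI)
  qed
  then show "X = X0 \<union> Suc ` Y1" "X0 \<inter> Suc ` Y1 = {}"
    by (auto simp: X0_def Y1_def)
qed

lemma X0_sub: "X0 \<subseteq> insert 1 (Suc ` P)"
proof
  fix x assume x: "x \<in> X0"
  show "x \<in> insert 1 (Suc ` P)"
  proof (cases "x = 1")
    case False
    then have "x - 1 \<in> P" "x = Suc (x - 1)" using x X_pred[of x] by (auto simp: X0_def P_def)
    then show ?thesis by (metis image_eqI insertI2)
  qed simp
qed

lemma card_X: "int (card X) \<le> int (card P) + 1 + int (card Y1)"
proof -
  have "card X0 \<le> card (insert 1 (Suc ` P))"
    using X0_sub XY(9) by (intro card_mono) auto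
  also have "\<dots> \<le> card P + 1"
    using card_insert_le_m1[of "card P + 1" "Suc ` P" 1] card_image_le[OF XY(9), of Suc] by simp
  finally have "card X0 \<le> card P + 1" .
  moreover have "card X = card X0 + card Y1"
    using card_Un_disjoint[of X0 "Suc ` Y1"] X1 Y01 by (simp add: card_image)
  ultimately show ?thesis by simp
qed

text \<open>\<open>v\<close> sees all of \<open>P\<close> and at most \<open>card X\<close> vertices
  of \<open>A\<close>. The 1 that label 1 adds in \<open>card_X\<close> uses up one of the two units
  in balance at most -2; the other makes the inequality strict.\<close>

lemma cnt_Y_v: "cnt Y v + 1 \<le> int (card Y1)"
  using D_v[OF G(1)] bal_cnt[OF AB(5)] cnt_B_split[of v] cnt_P_v cnt_A_v cnt_le_card[of X v] card_X
  by simp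

lemma d_v: "int (d v) \<le> int (card P) + cnt Y v + int (card X)"
  using cnt_V[OF vV] cnt_B_split[of v] cnt_P_v cnt_A_v cnt_le_card[of X v] by simp

text \<open>\<open>w\<close> sees all of \<open>P\<close> and all of \<open>X\<close>, at least as
  much there as \<open>v\<close>; since its degree is no larger, it cannot see more of
  \<open>Y\<close>.\<close>

lemma cnt_Y_later_B:
  assumes w: "w \<in> Y" "v \<le> w" and y: "y \<in> Y" "G w y"
  shows "cnt Y w \<le> cnt Y v"
proof -
  have wB: "w \<in> B" "w \<in> {1..n}" using memY[OF w(1)] by (auto simp: B_def)
  have "cnt P w = int (card P)"
    by (rule cnt_full) (use B_complete_P[OF wB(1) y] memP w in blast)
  moreover have "cnt X w = int (card X)"
    by (rule cnt_full) (use B_complete_X[OF wB(1) y(1) _ y(2)] in blast)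
  moreover have "cnt X w \<le> cnt A w" using AB(3) XY(1) by (rule cnt_mono)
  moreover have "int (d w) \<le> int (d v)" using mono[of v w] w(2) wB vV by simp
  ultimately show ?thesis
    using d_v cnt_V[OF wB(2)] cnt_B_split[of w] by simp
qed

lemma cnt_Y_later_A:
  assumes c: "c \<in> A" "c \<notin> R" "c \<notin> X" "v < c" and y: "y \<in> Y" "G c y"
  shows "cnt Y c \<le> cnt Y v"
proof -
  have cV: "c \<in> {1..n}" "c \<noteq> v" using c by (auto simp: A_def)
  have "cnt P c = int (card P)"
    by (rule cnt_full) (use A_complete_P[OF c(1) cV(2) y] in blast)
  moreover have "cnt X c = int (card X)"
    by (rule cnt_full) (use notR_complete_X[OF c(1,2) y(1) _ y(2)] c in blast)
  moreover have "cnt X c \<le> cnt A c" using AB(3) XY(1) by (rule cnt_mono)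
  moreover have "int (d c) \<le> int (d v)" using mono[of v c] c(4) cV vV by simp
  ultimately show ?thesis
    using d_v cnt_V[OF cV(1)] cnt_B_split[of c] by simp
qed

definition U :: "nat set" where "U = R - {v}"

lemma U_props:
  assumes "u \<in> U"
  shows "u - 1 \<in> B" "Suc (u - 1) = u" "v \<le> u - 1" "u \<in> R" "u \<in> A" "u \<noteq> v"
proof -
  have "u \<in> A" "v < u" "u \<in> R" "u \<noteq> v" using assms R_props(1)[of u] R_sub(1) by (auto simp: U_def)
  then show "u - 1 \<in> B" "Suc (u - 1) = u" "v \<le> u - 1" "u \<in> R" "u \<in> A" "u \<noteq> v"
    using vV by (auto simp: A_def B_def)
qed

lemma U_sub: "finite U" "U \<subseteq> R"
  using R_sub by (auto simp: U_def)

lemma inj_pred: "S \<subseteq> U \<Longrightarrow> inj_on (\<lambda>u. u - 1) S"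
  using U_props(2) by (intro inj_onI) (metis subsetD)

lemma card_pred: "S \<subseteq> U \<Longrightarrow> card ((\<lambda>u. u - 1) ` S) = card S"
  using inj_pred by (rule card_image)

text \<open>The zero condition prevents double spending: if \<open>Suc b\<close> is in
  \<open>R\<close>, every member of \<open>Bneg b\<close> sees \<open>R\<close>, so the slack of
  that pair is left for \<open>Suc b\<close>.\<close>

definition Bzero :: "nat \<Rightarrow> nat set" where
  "Bzero b = {c \<in> Bneg b. f c = 0}"

definition C :: "nat set" where
  "C = {c \<in> A. c \<notin> R \<and> c \<notin> X \<and> v < c \<and> (\<exists>w\<in>Y0. G c w)}"

text \<open>Here \<open>u - 1\<close> offers no slack of its own. It turns out to see nothing of
  \<open>Y\<close>, and nothing of \<open>X\<close> beyond \<open>X0\<close>, whereas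
  \<open>u\<close> sees all of \<open>P\<close>, all of \<open>X0\<close> and something in
  \<open>Y\<close>. As the degree of \<open>u - 1\<close> is no smaller, it must have a neighbour in
  \<open>A - X\<close>.\<close>

lemma zero_class:
  assumes u: "u \<in> U" "u - 1 \<in> Y0" "f (u - 1) = 0"
    and no_neg: "\<And>b. b \<in> Y1 \<Longrightarrow> u - 1 \<notin> Bneg b" and full: "\<And>x. x \<in> X0 \<Longrightarrow> G u x"
  shows "\<exists>c\<in>C. G c (u - 1)"
proof -
  let ?w = "u - 1"
  note U = U_props[OF u(1)]
  have wY: "?w \<in> Y" using u Y01 by blast
  have ne: "b \<noteq> ?w" if "b \<in> Y1" for b using that u Y01 by blast
  have noY: "\<not> G ?w y" if y: "y \<in> Y" for y
  \<comment> \<open>One neighbour in \<open>Y\<close> would force all of \<open>X\<close>, then, in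
    the absence of \<open>Bneg\<close>, all of \<open>Y1\<close>. That is more of \<open>Y\<close>
    than \<open>v\<close> sees.\<close>
  proof
    assume wy: "G ?w y"
    have "G ?w b" if b: "b \<in> Y1" for b
    proof -
      have "Suc b \<in> X" using b by (simp add: Y1_def)
      then have "G ?w (Suc b)" using B_complete_X[OF U(1) y _ wy] by blast
      then show ?thesis using no_neg[OF b] ne[OF b] U(1) by (auto simp: Bneg_def)
    qed
    then have "cnt Y1 ?w = int (card Y1)" by (rule cnt_full)
    moreover have "cnt Y1 ?w \<le> cnt Y ?w" using XY(8) Y01(2) by (rule cnt_mono)
    ultimately show False
      using cnt_Y_later_B[OF wY U(3) y wy] cnt_Y_v by simp
  qed
  have noX: "\<not> G ?w (Suc b)" if b: "b \<in> Y1" for b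
    using no_neg[OF b] ne[OF b] noY[of b] U(1) b Y01(2) unfolding Bneg_def by blast
  have "cnt Y ?w = 0" using noY by (simp add: cnt_def)
  moreover have "cnt P ?w \<le> int (card P)" by (rule cnt_le_card)
  moreover have "cnt A ?w = cnt X0 ?w + cnt (A - X) ?w"
  proof -
    have "A = X \<union> (A - X)" using XY(1) by blast
    then have "cnt A ?w = cnt X ?w + cnt (A - X) ?w"
      using cnt_Un[of X "A - X" ?w] XY(7) AB(3) by auto
    moreover have "cnt X ?w = cnt X0 ?w"
      unfolding cnt_def by (rule sum.mono_neutral_right) (use XY(7) Y01(7) X1(1) noX in auto)
    ultimately show ?thesis by simp
  qed
  moreover have "cnt X0 ?w \<le> int (card X0)" by (rule cnt_le_card)
  moreover have "cnt X0 u = int (card X0)" using full by (rule cnt_full)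
  moreover have "cnt X0 u \<le> cnt A u" using AB(3) XY(1) Y01(7) by (intro cnt_mono) auto
  moreover have "cnt P u = int (card P)" by (rule cnt_full) (use R_complete_P U(4) in blast)
  moreover have "1 \<le> cnt Y u"
  proof -
    obtain y where "y \<in> Y" "G u y" using R_props(3)[OF U(4,6)] by blast
    then have "0 < card {y \<in> Y. G u y}" using XY(8) by (auto simp: card_gt_0_iff)
    then show ?thesis using XY(8) by (simp add: cnt_card)
  qed
  moreover have "int (d u) \<le> int (d ?w)"
    using mono[of ?w u] U(1,2,5) by (auto simp: A_def B_def)
  moreover have "?w \<in> {1..n}" "u \<in> {1..n}" using U(1,5) by (auto simp: A_def B_def)
  ultimately have "1 \<le> cnt (A - X) ?w"
    using cnt_V[of u] cnt_V[of ?w] cnt_B_split[of u] cnt_B_split[of ?w] by simp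
  then obtain c where c: "c \<in> A" "c \<notin> X" "G ?w c"
    by (force simp: cnt_def dest: sum_pos2 intro: ccontr)
  have "c \<notin> R"
  proof
    assume "c \<in> R"
    then have "0 < card {r \<in> R. G ?w r}" using c(3) R_sub(3) by (auto simp: card_gt_0_iff)
    moreover have "f ?w = int (card {r \<in> R. G ?w r})"
      unfolding f_def by (rule cnt_card) (rule R_sub(3))
    ultimately show False using u(3) by linarith
  qed
  moreover have "v < c"
  proof (rule ccontr)
    assume "\<not> v < c"
    moreover have "c \<noteq> v" using \<open>c \<notin> R\<close> R_sub(2) by blast
    ultimately obtain x where x: "x \<in> X" "x - 1 \<in> Y" "G ?w x"
      using earlier_nbr[OF c(1,2) _ U(1) c(3)] by auto
    moreover have "x \<notin> X0" using x(2) by (simp add: X0_def)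
    ultimately have "x \<in> Suc ` Y1" using X1(1) by blast
    then show False using x(3) noX by blast
  qed
  ultimately have "c \<in> C" using c u(2) G_symm by (auto simp: C_def)
  then show ?thesis using c(3) G_symm by blast
qed

end

section \<open>Distributing the slack among the members of R other than v\<close>

context odd_peg_hole
begin

lemma P_units:
  assumes T: "T \<subseteq> R" and units: "\<And>u. u \<in> T \<Longrightarrow> u - 1 \<in> P \<and> u \<in> U \<or> (\<exists>x\<in>X0. \<not> G u x)"
  shows "int (card T) \<le> (\<Sum>b\<in>P. \<phi> b) + (m - (if 1 \<in> insert v X then f 1 else 0))"
proof -
  \<comment> \<open>Outside \<open>insert v X\<close> nothing is subtracted and the slack is
    \<open>m \<ge> 1\<close>, enough for the single entry \<open>h\<close>.\<close>
  define K where "K h = (if h \<in> insert v X then {u \<in> R. \<not> G u h} else {h})" for h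
  let ?H = "insert 1 (Suc ` P)"
  have fin: "finite ?H" "finite (K h)" for h using XY(9) R_sub(3) by (auto simp: K_def)
  have K_P: "int (card (K (Suc b))) \<le> \<phi> b" if "b \<in> P" for b
    using that \<phi>_P[OF that] m_pos by (auto simp: K_def \<phi>_def)
  have K_1: "int (card (K 1)) \<le> m - (if 1 \<in> insert v X then f 1 else 0)"
    using m_minus_f[of 1] m_pos by (auto simp: K_def)
  have "T \<subseteq> (\<Union>h\<in>?H. K h)"
  proof
    fix u assume u: "u \<in> T"
    consider "u - 1 \<in> P" "u \<in> U" | x where "x \<in> X0" "\<not> G u x" using units[OF u] by blast
    then show "u \<in> (\<Union>h\<in>?H. K h)"
    proof cases
      case 1
      then have "u \<in> ?H" using U_props(2) by (metis image_eqI insertI2)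
      moreover have "u \<in> K u" using 1 U_props(4) by (auto simp: K_def)
      ultimately show ?thesis by blast
    next
      case 2
      then have "x \<in> ?H" "u \<in> K x" using X0_sub Y01(7) u T by (auto simp: K_def)
      then show ?thesis by blast
    qed
  qed
  then have "card T \<le> card (\<Union>h\<in>?H. K h)"
    using fin by (intro card_mono finite_UN_I)
  also have "\<dots> \<le> (\<Sum>h\<in>?H. card (K h))"
    using fin(1) by (rule card_UN_le)
  finally have "int (card T) \<le> (\<Sum>h\<in>?H. int (card (K h)))"
    by (metis of_nat_mono of_nat_sum)
  also have "\<dots> = int (card (K 1)) + (\<Sum>h\<in>Suc ` P. int (card (K h)))"
  proof (rule sum.insert)
    show "1 \<notin> Suc ` P" using XY(3) by (auto simp: B_def)
  qed (use XY(9) in simp)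
  also have "(\<Sum>h\<in>Suc ` P. int (card (K h))) = (\<Sum>b\<in>P. int (card (K (Suc b))))"
    by (subst sum.reindex) auto
  also have "\<dots> \<le> (\<Sum>b\<in>P. \<phi> b)" using K_P by (rule sum_mono)
  finally show ?thesis using K_1 by linarith
qed

lemma Y0_units:
  assumes T: "T \<subseteq> U" "\<And>u. u \<in> T \<Longrightarrow> u - 1 \<in> Y0 \<and> f (u - 1) \<noteq> 0"
  shows "int (card T) \<le> (\<Sum>b\<in>Y0. \<phi> b)"
proof -
  let ?T = "(\<lambda>u. u - 1) ` T"
  have sub: "?T \<subseteq> Y0" using T(2) by auto
  have Y0: "\<phi> b = f b" if "b \<in> Y0" for b using \<phi>_Y_free that by (auto simp: Y0_def)
  have "int (card T) = (\<Sum>b\<in>?T. 1)" using card_pred[OF T(1)] by simp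
  also have "\<dots> \<le> (\<Sum>b\<in>?T. \<phi> b)"
  proof (rule sum_mono)
    fix b assume b: "b \<in> ?T"
    then have "f b \<noteq> 0" "b \<in> Y0" using T(2) by auto
    then show "1 \<le> \<phi> b" using f_nonneg[of b] Y0 by simp
  qed
  also have "\<dots> \<le> (\<Sum>b\<in>Y0. \<phi> b)"
    by (rule sum_mono2) (use sub Y01(4) Y0 f_nonneg in auto)
  finally show ?thesis .
qed

text \<open>If \<open>Suc b\<close> is in \<open>U\<close>, it has a neighbour \<open>y\<close> in
  \<open>Y\<close>. Either \<open>b\<close> and \<open>Suc b\<close> are adjacent, or
  \<open>b\<close> misses \<open>y\<close> by \<open>B_complete_X\<close> and \<open>y\<close> is in
  \<open>Bneg b\<close>; both give a unit. Otherwise the slack is free for \<open>Bzero\<close> and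
  \<open>Aneg\<close>.\<close>

lemma Y1_pair:
  assumes b: "b \<in> Y1"
    and M: "M \<subseteq> U" "\<And>u. u \<in> M \<Longrightarrow> u - 1 \<in> Y1 \<Longrightarrow>
      2 \<le> int (card (Bneg (u - 1))) + of_bool (G (u - 1) u)"
  shows "of_bool (Suc b \<in> U) + of_bool (Suc b \<in> M) + int (card (Bzero b)) + int (card (Aneg b)) \<le> \<phi> b"
proof -
  have bY: "b \<in> Y" "Suc b \<in> X" "b \<in> B" using b memY by (auto simp: Y1_def)
  have fin: "finite (Bneg b)" using AB(4) by (simp add: Bneg_def)
  note slack = pair_slack[OF bY(1,2)]
  show ?thesis
  proof (cases "Suc b \<in> U")
    case False
    then have "Suc b \<notin> M" using M(1) by blast
    moreover have "int (card (Bzero b)) \<le> int (card (Bneg b))"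
      using fin by (intro of_nat_mono card_mono) (auto simp: Bzero_def)
    moreover have "0 \<le> (of_bool (Suc b \<in> R \<and> G b (Suc b)) :: int)" by simp
    moreover have "int (card (Bneg b)) + int (card (Aneg b)) \<le> \<phi> b"
      by (rule order_trans[OF _ slack]) simp
    ultimately show ?thesis using False by simp
  next
    case True
    note u = U_props[OF True]
    have "f c \<noteq> 0" if "c \<in> Bneg b" for c
    proof -
      have "0 < card {r \<in> R. G c r}"
        using that u(4) R_sub(3) by (auto simp: card_gt_0_iff Bneg_def)
      moreover have "f c = int (card {r \<in> R. G c r})"
        unfolding f_def by (rule cnt_card) (rule R_sub(3))
      ultimately show ?thesis by linarith
    qed
    then have zero: "Bzero b = {}" by (auto simp: Bzero_def)
    have one: "1 \<le> int (card (Bneg b)) + of_bool (G b (Suc b))"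
    proof (cases "G b (Suc b)")
      case True
      then show ?thesis by simp
    next
      case False
      obtain y where y: "y \<in> Y" "G (Suc b) y" using R_props(3)[OF u(4,6)] by blast
      have "\<not> G b y" using B_complete_X[OF bY(3) y(1) bY(2)] False by blast
      then have "y \<in> Bneg b"
        using y memY[OF y(1)] False G_symm by (auto simp: Bneg_def)
      then have "0 < card (Bneg b)" using fin by (auto simp: card_gt_0_iff)
      then show ?thesis by simp
    qed
    have two: "1 + of_bool (Suc b \<in> M) \<le> int (card (Bneg b)) + of_bool (G b (Suc b))"
      using one M(2)[of "Suc b"] b by (cases "Suc b \<in> M") auto
    show ?thesis using slack two zero True u(4) by simp
  qed
qed

text \<open>A vertex \<open>c\<close> of \<open>C\<close> sees fewer than \<open>card Y1\<close>
  vertices of \<open>Y\<close>, so each neighbour in \<open>Y0\<close> is matched by some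
  \<open>b\<close> of \<open>Y1\<close> that it misses. As \<open>c\<close> sees all of
  \<open>X\<close>, missing \<open>b\<close> puts it into \<open>Aneg b\<close>.\<close>

lemma Aneg_units:
  assumes T: "T \<subseteq> U" "\<And>u. u \<in> T \<Longrightarrow> u - 1 \<in> Y0 \<and> (\<exists>c\<in>C. G c (u - 1))"
  shows "int (card T) \<le> (\<Sum>b\<in>Y1. int (card (Aneg b)))"
proof -
  have finC: "finite C" using AB(3) by (simp add: C_def)
  have miss: "cnt Y0 c \<le> (\<Sum>b\<in>Y1. of_bool (c \<in> Aneg b))" if c: "c \<in> C" for c
  proof -
    obtain w where w: "c \<in> A" "c \<notin> R" "c \<notin> X" "v < c" "w \<in> Y" "G c w"
      using c Y01(1) by (auto simp: C_def)
    have "cnt Y c \<le> cnt Y v" by (rule cnt_Y_later_A[OF w])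
    moreover have "cnt Y0 c + cnt Y1 c \<le> cnt Y c"
      using cnt_Un[OF Y01(4,5,3), of c] cnt_mono[OF XY(8), of "Y0 \<union> Y1" c] Y01(1,2) by simp
    ultimately have "cnt Y0 c \<le> int (card Y1) - cnt Y1 c" using cnt_Y_v by simp
    also have "\<dots> = (\<Sum>b\<in>Y1. 1 - of_bool (G c b))"
      by (simp add: sum_subtractf cnt_def)
    also have "\<dots> \<le> (\<Sum>b\<in>Y1. of_bool (c \<in> Aneg b))"
    proof (rule sum_mono)
      fix b assume b: "b \<in> Y1"
      then have X: "Suc b \<in> X" by (simp add: Y1_def)
      then have "c \<noteq> Suc b" using w(3) by blast
      then have "G c (Suc b)" using notR_complete_X[OF w(1,2,5) X w(6)] by blast
      then show "1 - of_bool (G c b) \<le> (of_bool (c \<in> Aneg b) :: int)"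
        using w \<open>c \<noteq> Suc b\<close> by (auto simp: Aneg_def)
    qed
    finally show ?thesis .
  qed
  have "(\<lambda>u. u - 1) ` T \<subseteq> (\<Union>c\<in>C. {w \<in> Y0. G c w})" using T(2) by blast
  then have "card ((\<lambda>u. u - 1) ` T) \<le> card (\<Union>c\<in>C. {w \<in> Y0. G c w})"
    using finC Y01(4) by (intro card_mono) auto
  also have "\<dots> \<le> (\<Sum>c\<in>C. card {w \<in> Y0. G c w})" using finC by (rule card_UN_le)
  finally have "card T \<le> (\<Sum>c\<in>C. card {w \<in> Y0. G c w})"
    using card_pred[OF T(1)] by simp
  then have "int (card T) \<le> int (\<Sum>c\<in>C. card {w \<in> Y0. G c w})"
    by (rule of_nat_mono)
  also have "\<dots> = (\<Sum>c\<in>C. cnt Y0 c)" by (simp add: cnt_card[OF Y01(4)])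
  also have "\<dots> \<le> (\<Sum>c\<in>C. \<Sum>b\<in>Y1. of_bool (c \<in> Aneg b))" using miss by (rule sum_mono)
  also have "\<dots> = (\<Sum>b\<in>Y1. \<Sum>c\<in>C. of_bool (c \<in> Aneg b))" by (rule sum.swap)
  also have "\<dots> \<le> (\<Sum>b\<in>Y1. int (card (Aneg b)))"
  proof (rule sum_mono)
    fix b
    have "(\<Sum>c\<in>C. of_bool (c \<in> Aneg b)) = int (card {c \<in> C. c \<in> Aneg b})"
      by (rule card_filter_of_bool[symmetric]) (rule finC)
    also have "\<dots> \<le> int (card (Aneg b))"
      by (rule of_nat_mono, rule card_mono) (use AB(3) in \<open>auto simp: Aneg_def\<close>)
    finally show "(\<Sum>c\<in>C. of_bool (c \<in> Aneg b)) \<le> int (card (Aneg b))" .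
  qed
  finally show ?thesis .
qed

lemma Bzero_units:
  assumes T: "T \<subseteq> U" "\<And>u. u \<in> T \<Longrightarrow> \<exists>b\<in>Y1. u - 1 \<in> Bzero b"
  shows "int (card T) \<le> (\<Sum>b\<in>Y1. int (card (Bzero b)))"
proof -
  have "(\<lambda>u. u - 1) ` T \<subseteq> (\<Union>b\<in>Y1. Bzero b)" using T(2) by blast
  then have "card ((\<lambda>u. u - 1) ` T) \<le> card (\<Union>b\<in>Y1. Bzero b)"
    using Y01(5) AB(4) by (intro card_mono) (auto simp: Bzero_def Bneg_def)
  also have "\<dots> \<le> (\<Sum>b\<in>Y1. card (Bzero b))" using Y01(5) by (rule card_UN_le)
  finally have "card T \<le> (\<Sum>b\<in>Y1. card (Bzero b))"
    using card_pred[OF T(1)] by simp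
  then have "int (card T) \<le> int (\<Sum>b\<in>Y1. card (Bzero b))"
    by (rule of_nat_mono)
  then show ?thesis by simp
qed

lemma shifted_sum:
  assumes "M \<subseteq> U"
  shows "(\<Sum>b\<in>Y1. of_bool (Suc b \<in> M)) = int (card {u \<in> M. u - 1 \<in> Y1})"
proof -
  have "(\<lambda>u. u - 1) ` {u \<in> M. u - 1 \<in> Y1} = {b \<in> Y1. Suc b \<in> M}"
    using assms U_props(2) by (force simp: image_iff)
  moreover have "card ((\<lambda>u. u - 1) ` {u \<in> M. u - 1 \<in> Y1}) = card {u \<in> M. u - 1 \<in> Y1}"
    using assms by (intro card_pred) auto
  ultimately show ?thesis
    using card_filter_of_bool[OF Y01(5), of "\<lambda>b. Suc b \<in> M"] by simp
qed

text \<open>Members of \<open>U\<close> are sorted by predecessor, and those whose predecessor lies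
  in \<open>Y0\<close> and sees nothing of \<open>R\<close> by the reason found in
  \<open>zero_class\<close>. The groups draw on disjoint shares of the slack; members of
  \<open>M\<close> receive a second unit.\<close>

lemma unit_count:
  assumes M: "M \<subseteq> U" "\<And>u. u \<in> M \<Longrightarrow> u - 1 \<in> Y1 \<and>
      2 \<le> int (card (Bneg (u - 1))) + of_bool (G (u - 1) u)"
  shows "int (card U) + int (card M) \<le> (\<Sum>b\<in>P \<union> Y0 \<union> Y1. \<phi> b)
    + (m - (if 1 \<in> insert v X then f 1 else 0))"
proof -
  define Ua where "Ua = {u \<in> U. u - 1 \<in> P}"
  define Ug where "Ug = {u \<in> U. u - 1 \<in> Y0 \<and> f (u - 1) \<noteq> 0}"
  define U1 where "U1 = {u \<in> U. u - 1 \<in> Y1}"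
  define Uz where "Uz = {u \<in> U. u - 1 \<in> Y0 \<and> f (u - 1) = 0}"
  define Uneg where "Uneg = {u \<in> Uz. \<exists>b\<in>Y1. u - 1 \<in> Bneg b}"
  define Ux where "Ux = {u \<in> Uz - Uneg. \<exists>x\<in>X0. \<not> G u x}"
  define Uc where "Uc = Uz - Uneg - Ux"
  have fin: "finite Ua" "finite Ug" "finite U1" "finite Uz" "finite Uneg" "finite Ux" "finite Uc"
    using U_sub(1) by (auto simp: Ua_def Ug_def U1_def Uz_def Uneg_def Ux_def Uc_def)
  have "u - 1 \<in> P \<or> u - 1 \<in> Y0 \<or> u - 1 \<in> Y1" if "u \<in> U" for u
    using U_props[OF that] by (auto simp: P_def Y0_def Y1_def)
  then have U: "U = (Ua \<union> Ux) \<union> Ug \<union> U1 \<union> Uneg \<union> Uc"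
    by (auto simp: Ua_def Ug_def U1_def Uz_def Uneg_def Ux_def Uc_def)
  have "card U \<le> card (Ua \<union> Ux) + card Ug + card U1 + card Uneg + card Uc"
    unfolding U by (meson add_mono card_Un_le le_trans order_refl)
  moreover have "int (card (Ua \<union> Ux)) \<le> (\<Sum>b\<in>P. \<phi> b) + (m - (if 1 \<in> insert v X then f 1 else 0))"
    by (rule P_units) (use U_sub(2) in \<open>auto simp: Ua_def Ux_def Uz_def\<close>)
  moreover have "int (card Ug) \<le> (\<Sum>b\<in>Y0. \<phi> b)"
    by (rule Y0_units) (auto simp: Ug_def)
  moreover have "int (card U1) + int (card M) + int (card Uneg) + int (card Uc) \<le> (\<Sum>b\<in>Y1. \<phi> b)"
  proof -
    have "int (card U1) = (\<Sum>b\<in>Y1. of_bool (Suc b \<in> U))"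
      using shifted_sum[of U] by (simp add: U1_def)
    moreover have "int (card M) = (\<Sum>b\<in>Y1. of_bool (Suc b \<in> M))"
    proof -
      have "{u \<in> M. u - 1 \<in> Y1} = M" using M(2) by blast
      then show ?thesis using shifted_sum[OF M(1)] by simp
    qed
    moreover have "int (card Uneg) \<le> (\<Sum>b\<in>Y1. int (card (Bzero b)))"
      by (rule Bzero_units) (auto simp: Uneg_def Uz_def Bzero_def)
    moreover have "int (card Uc) \<le> (\<Sum>b\<in>Y1. int (card (Aneg b)))"
    proof (rule Aneg_units)
      show "Uc \<subseteq> U" by (auto simp: Uc_def Uz_def)
      show "u - 1 \<in> Y0 \<and> (\<exists>c\<in>C. G c (u - 1))" if "u \<in> Uc" for u
        using zero_class[of u] that by (auto simp: Uc_def Ux_def Uneg_def Uz_def)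
    qed
    ultimately have "int (card U1) + int (card M) + int (card Uneg) + int (card Uc)
      \<le> (\<Sum>b\<in>Y1. of_bool (Suc b \<in> U) + of_bool (Suc b \<in> M) + int (card (Bzero b)) + int (card (Aneg b)))"
      by (simp only: sum.distrib)
    also have "\<dots> \<le> (\<Sum>b\<in>Y1. \<phi> b)"
      by (rule sum_mono, rule Y1_pair) (use M in auto)
    finally show ?thesis .
  qed
  moreover have "(\<Sum>b\<in>P \<union> Y0 \<union> Y1. \<phi> b) = (\<Sum>b\<in>P. \<phi> b) + (\<Sum>b\<in>Y0. \<phi> b) + (\<Sum>b\<in>Y1. \<phi> b)"
  proof -
    have "(P \<union> Y0) \<inter> Y1 = {}" "P \<inter> Y0 = {}" using Y01 XY(10) by blast+
    then show ?thesis using XY(9) Y01(4,5) by (simp add: sum.union_disjoint)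
  qed
  ultimately show ?thesis by linarith
qed

text \<open>\<open>U\<close> has \<open>m - 1\<close> members, so the units almost cover the
  possible loss \<open>m\<close> at label 1. In the remaining case the second units for
  \<open>M\<close> offset the deficit of the pair \<open>v - 1, v\<close>, as for even
  \<open>v\<close>.\<close>

lemma no_hole_if_odd: False
proof -
  let ?t = "m - (if 1 \<in> insert v X then f 1 else 0)"
  have cardU: "int (card U) = m - 1"
    using R_sub m_pos by (simp add: U_def m_def of_nat_diff Suc_le_eq)
  have total: "(\<Sum>u\<in>R. bal n G u) = (\<Sum>b\<in>B. \<phi> b) + ?t - m"
    using sum_bal by simp
  show False
  proof (cases "v - 1 \<in> Y \<longrightarrow> split_nbr")
    case True
    have "(\<Sum>b\<in>P \<union> Y0 \<union> Y1. \<phi> b) \<le> (\<Sum>b\<in>B. \<phi> b)"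
    proof (rule sum_mono2)
      show "P \<union> Y0 \<union> Y1 \<subseteq> B" using Y01 XY by blast
      show "0 \<le> \<phi> b" if "b \<in> B - (P \<union> Y0 \<union> Y1)" for b
        using that True by (intro \<phi>_nonneg) auto
    qed (rule AB(4))
    moreover have "int (card U) + int (card ({} :: nat set)) \<le> (\<Sum>b\<in>P \<union> Y0 \<union> Y1. \<phi> b) + ?t"
      by (rule unit_count) auto
    ultimately show False
      using total cardU sum_bal_le[of "{}"] by simp
  next
    case False
    then have y: "v - 1 \<in> Y" "\<not> split_nbr" by auto
    define N where "N = {u \<in> R. G v u}"
    define M where "M = {u \<in> N. 0 \<le> bal n G u}"
    have N: "N \<subseteq> R - {v}" "finite N" using R_sub by (auto simp: N_def)
    then have MU: "M \<subseteq> U" by (auto simp: M_def U_def)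
    have vB: "v - 1 \<in> B" using memY[OF y(1)] by simp
    then have Suc_v: "Suc (v - 1) = v" by (auto simp: B_def)
    have M2: "u - 1 \<in> Y1 \<and> 2 \<le> int (card (Bneg (u - 1))) + of_bool (G (u - 1) u)" if u: "u \<in> M" for u
    proof -
      have uU: "u \<in> U" using u MU by blast
      note U = U_props[OF uU]
      \<comment> \<open>\<open>Y\<close> is a final segment of the even labels and contains
        \<open>v - 1\<close>, hence everything later.\<close>
      have "u - 1 \<in> Y" using y(1) U(1,3) by (auto simp: Y_label)
      moreover have "u \<in> X" using u nbr_v[of u] U(5) by (auto simp: M_def N_def)
      ultimately have "u - 1 \<in> Y1" using U(2) by (simp add: Y1_def)
      moreover have "2 \<le> int (card (Bneg (u - 1))) + of_bool (G (u - 1) u)"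
        by (rule two_units[OF y(2,1)]) (use u U \<open>u - 1 \<in> Y\<close> in \<open>auto simp: M_def N_def\<close>)
      ultimately show ?thesis by blast
    qed
    have "int (card U) + int (card M) \<le> (\<Sum>b\<in>P \<union> Y0 \<union> Y1. \<phi> b) + ?t"
      using MU M2 by (rule unit_count)
    moreover have "(\<Sum>b\<in>B. \<phi> b) = (\<Sum>b\<in>P \<union> Y0 \<union> Y1. \<phi> b) + \<phi> (v - 1)"
    proof -
      have "B = insert (v - 1) (P \<union> Y0 \<union> Y1)" "v - 1 \<notin> P \<union> Y0 \<union> Y1"
        using Suc_v vB y(1) XY(4) by (auto simp: P_def Y0_def Y1_def memY)
      moreover have "finite (P \<union> Y0 \<union> Y1)" using XY(9) Y01 by simp
      ultimately show ?thesis by simp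
    qed
    moreover have "\<phi> (v - 1) = f (v - 1) - f v" using y Suc_v by (simp add: \<phi>_def P_def)
    moreover have "f v = int (card N)" using R_sub(3) by (simp add: f_def cnt_card N_def)
    moreover have "card N = card M + card {u \<in> N. bal n G u < 0}"
    proof -
      have "card N = card (M \<union> {u \<in> N. bal n G u < 0})"
        by (rule arg_cong[of _ _ card]) (auto simp: M_def)
      also have "\<dots> = card M + card {u \<in> N. bal n G u < 0}"
        by (rule card_Un_disjoint) (use N in \<open>auto simp: M_def\<close>)
      finally show ?thesis .
    qed
    ultimately show False
      using total cardU f_nonneg[of "v - 1"] sum_bal_le[OF N(1)] by simp
  qed
qed

end

section \<open>Choosing the extremal family\<close>

lemma finite_arg_min_int:
  fixes g :: "'a \<Rightarrow> int"
  assumes "finite S" "S \<noteq> {}"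
  obtains x where "x \<in> S" "\<And>y. y \<in> S \<Longrightarrow> g x \<le> g y"
proof -
  obtain x where "x \<in> S" "g x = Min (g ` S)"
    using assms Min_in[of "g ` S"] by fastforce
  then show thesis using assms that[of x] by simp
qed

lemma bounded_arg_max_int:
  fixes g :: "'a \<Rightarrow> int"
  assumes "Q x" "\<And>y. Q y \<Longrightarrow> g y \<le> c"
  obtains z where "Q z" "\<And>y. Q y \<Longrightarrow> g y \<le> g z"
proof -
  obtain z where z: "Q z" "\<forall>y. Q y \<longrightarrow> nat (c - g z) \<le> nat (c - g y)"
    using ex_has_least_nat[of Q x "\<lambda>y. nat (c - g y)"] assms(1) by blast
  have "g y \<le> g z" if "Q y" for y
    using z(2) that assms(2)[OF that] assms(2)[OF z(1)] by (auto simp: nat_le_eq_zle)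
  then show thesis using that z(1) by blast
qed

lemma bal_le: "bal n E u \<le> int n"
proof -
  have "bal n E u \<le> (\<Sum>w\<in>nb n E u. 1)"
    unfolding bal_def by (rule sum_mono) (simp add: chi_def)
  also have "\<dots> \<le> int (card {1..n})"
    proof -
    have "card (nb n E u) \<le> card {1..n}" by (rule card_mono) (auto simp: nb_def)
    then show ?thesis by simp
  qed
  finally show ?thesis by simp
qed

lemma sum_bal_bound: "finite S \<Longrightarrow> (\<Sum>u\<in>S. bal n E u) \<le> int (card S) * int n"
  using sum_mono[of S "\<lambda>u. bal n E u" "\<lambda>_. int n"] bal_le by simp

lemma class_count:
  assumes gr: "realizes n d E" and u: "u \<in> {1..n}"
  shows "2 * int (card {w \<in> {1..n}. even w = p \<and> E w u}) = int (d u) + (if even u = p then - bal n E u else bal n E u)"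
proof -
  have N: "nb n E u = {w \<in> {1..n}. even w = p \<and> E w u} \<union> {w \<in> {1..n}. even w \<noteq> p \<and> E w u}"
    using realizes_comm[OF gr] by (auto simp: nb_def)
  let ?S = "{w \<in> {1..n}. even w = p \<and> E w u}" and ?O = "{w \<in> {1..n}. even w \<noteq> p \<and> E w u}"
  have disj: "?S \<inter> ?O = {}" by blast
  have "d u = card ?S + card ?O"
    using realizes_card[OF gr u] card_Un_disjoint[OF _ _ disj] N by simp
  moreover have "bal n E u = (\<Sum>w\<in>?S. chi u w) + (\<Sum>w\<in>?O. chi u w)"
    unfolding bal_def N by (rule sum.union_disjoint) auto
  moreover have "(\<Sum>w\<in>?S. chi u w) = (\<Sum>w\<in>?S. if even u = p then -1 else 1)"
    "(\<Sum>w\<in>?O. chi u w) = (\<Sum>w\<in>?O. if even u = p then 1 else -1)"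
    by (rule sum.cong; auto simp: chi_def)+
  ultimately show ?thesis by simp
qed

lemma class_card:
  fixes n :: nat
  shows "card {u \<in> {1..n}. even u = p} \<le> card {u \<in> {1..n}. even u \<noteq> p} + 1"
proof -
  let ?A = "{u \<in> {1..n}. even u = p}" and ?B = "{u \<in> {1..n}. even u \<noteq> p}"
  have "u - 1 \<in> ?B" if "u \<in> ?A - {1}" for u
    by (cases u) (use that in auto)
  then have sub: "(\<lambda>u. u - 1) ` (?A - {1}) \<subseteq> ?B" by blast
  have inj: "inj_on (\<lambda>u. u - 1) (?A - {1})" by (rule inj_onI) auto
  have "card (?A - {1}) \<le> card ?B" by (rule card_inj_on_le[OF inj sub]) simp
  then show ?thesis using card_Diff_singleton_if[of ?A 1] by (auto split: if_splits)
qed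

definition optimal :: "nat \<Rightarrow> (nat \<Rightarrow> nat) \<Rightarrow> (nat \<Rightarrow> nat \<Rightarrow> bool) \<Rightarrow> bool" where
  "optimal n d E \<longleftrightarrow> realizes n d E \<and> (\<forall>E'. realizes n d E' \<longrightarrow> total n E' \<le> total n E)"

lemma optimal_exists:
  assumes "realizes n d E"
  shows "\<exists>E. optimal n d E"
proof -
  have "total n F \<le> int n * int n" for F
    using sum_bal_bound[of "{1..n}"] by (simp add: total_def)
  then obtain F where "realizes n d F" "\<And>E'. realizes n d E' \<Longrightarrow> total n E' \<le> total n F"
    using bounded_arg_max_int[of "realizes n d" E "total n"] assms by blast
  then show ?thesis unfolding optimal_def by blast
qed

lemma optimal_total: "optimal n d E \<Longrightarrow> realizes n d E' \<Longrightarrow> total n E' = total n E \<Longrightarrow> optimal n d E'"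
  by (simp add: optimal_def)

text \<open>If every graph satisfying \<open>M\<close> has a deficient vertex in the class \<open>S\<close>, the largest deficient
  label is pushed down as far as possible, and then its balance up.\<close>

lemma worst_vertex:
  assumes M: "M E" and S: "S \<subseteq> {1..n}" and bad: "\<And>E. M E \<Longrightarrow> \<exists>u\<in>S. bal n E u < -1"
  obtains v F where "v \<in> S" "M F" "\<And>u. u \<in> S \<Longrightarrow> v < u \<Longrightarrow> -1 \<le> bal n F u" "bal n F v \<le> -2"
    "\<And>E. M E \<Longrightarrow> (\<And>u. u \<in> S \<Longrightarrow> v < u \<Longrightarrow> -1 \<le> bal n E u) \<Longrightarrow> bal n E v \<le> bal n F v"
proof -
  define ok where "ok k E \<longleftrightarrow> M E \<and> (\<forall>u\<in>S. k \<le> u \<longrightarrow> -1 \<le> bal n E u)" for k E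
  have "ok (Suc n) E" using M S by (auto simp: ok_def)
  then have ex: "\<exists>E. ok (Suc n) E" by blast
  define k where "k = (LEAST k. \<exists>E. ok k E)"
  have k: "\<exists>E. ok k E" unfolding k_def by (rule LeastI[of "\<lambda>k. \<exists>E. ok k E", OF ex])
  then obtain E0 where E0: "ok k E0" by blast
  have "k \<noteq> 0" using E0 bad[of E0] by (force simp: ok_def)
  then obtain v where v: "k = Suc v" by (cases k) auto
  have no: "\<not> ok v E" for E
    using not_less_Least[of v "\<lambda>k. \<exists>E. ok k E"] v unfolding k_def by auto
  have low: "v \<in> S \<and> bal n E v \<le> -2" if "ok k E" for E
  proof -
    have "\<exists>u\<in>S. v \<le> u \<and> bal n E u < -1"
      using no[of E] that by (auto simp: ok_def not_le)
    then obtain u where u: "u \<in> S" "v \<le> u" "bal n E u < -1" by blast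
    then have "\<not> k \<le> u" using that by (force simp: ok_def)
    then have "u = v" using u(2) v by simp
    then show ?thesis using u by simp
  qed
  obtain F where F: "ok k F" "\<And>E. ok k E \<Longrightarrow> bal n E v \<le> bal n F v"
    using bounded_arg_max_int[of "ok k" E0 "\<lambda>E. bal n E v" "-2"] low E0 by blast
  show thesis
  proof (rule that[of v F])
    show "bal n E v \<le> bal n F v" if "M E" "\<And>u. u \<in> S \<Longrightarrow> v < u \<Longrightarrow> -1 \<le> bal n E u" for E
      using that F(2)[of E] v by (simp add: ok_def Suc_le_eq)
  qed (use low[OF F(1)] F(1) v in \<open>auto simp: ok_def\<close>)
qed

text \<open>The class of \<open>v\<close> exceeds the other by at most one vertex, so seeing the
  whole other class gives balance at least -1.\<close>

lemma hole_exists: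
  assumes gr: "realizes n d E" and v: "v \<in> {1..n}" and bal: "bal n E v \<le> -2"
  shows "\<exists>y\<in>{1..n}. even y \<noteq> even v \<and> \<not> E v y"
proof (rule ccontr)
  assume "\<not> ?thesis"
  then have "{w \<in> {1..n}. even w = (\<not> even v) \<and> E w v} = {u \<in> {1..n}. even u \<noteq> even v}"
    using realizes_comm[OF gr] by auto
  then have 1: "2 * int (card {u \<in> {1..n}. even u \<noteq> even v}) = int (d v) + bal n E v"
    using class_count[OF gr v, of "\<not> even v"] by simp
  have "{w \<in> {1..n}. even w = even v \<and> E w v} \<subseteq> {u \<in> {1..n}. even u = even v}" by blast
  then have "card {w \<in> {1..n}. even w = even v \<and> E w v} \<le> card {u \<in> {1..n}. even u = even v}"
    by (rule card_mono[rotated]) simp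
  moreover have "2 * int (card {w \<in> {1..n}. even w = even v \<and> E w v}) = int (d v) - bal n E v"
    using class_count[OF gr v, of "even v"] by simp
  ultimately show False
    using class_card[of n "even v"] 1 bal by simp
qed

text \<open>Otherwise taking predecessors maps the odd neighbours of \<open>v\<close> other than 1
  injectively to even neighbours, and the balance is at least -1.\<close>

lemma peg_above:
  assumes gr: "realizes n d E" and v: "v \<in> {1..n}" "odd v" and bal: "bal n E v \<le> -2"
    and y: "even y" and below: "\<And>g. g \<in> {1..n} \<Longrightarrow> even g \<Longrightarrow> g < y \<Longrightarrow> E v g"
  shows "\<exists>x\<in>{1..n}. odd x \<and> E v x \<and> y < x"
proof (rule ccontr)
  assume neg: "\<not> ?thesis"
  let ?O = "{w \<in> {1..n}. even w = even v \<and> E w v}" and ?E = "{w \<in> {1..n}. even w = (\<not> even v) \<and> E w v}"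
  have "w - 1 \<in> ?E" if "w \<in> ?O - {1}" for w
  proof -
    have w: "w \<in> {1..n}" "odd w" "E v w" "w \<noteq> 1" "2 < w + 0 \<or> w \<le> 2"
      using that v realizes_comm[OF gr] by auto
    then have "w \<le> y" "w \<noteq> y" using neg y by auto
    then have "w - 1 \<in> {1..n}" "even (w - 1)" "w - 1 < y" using w by auto
    then show ?thesis using below[of "w - 1"] v realizes_comm[OF gr] by auto
  qed
  then have sub: "(\<lambda>u. u - 1) ` (?O - {1}) \<subseteq> ?E" by blast
  have inj: "inj_on (\<lambda>u. u - 1) (?O - {1})" by (rule inj_onI) auto
  have "card (?O - {1}) \<le> card ?E" by (rule card_inj_on_le[OF inj sub]) simp
  then have "card ?O \<le> card ?E + 1" using card_Diff_singleton_if[of ?O 1] by (auto split: if_splits)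
  then show False
    using class_count[OF gr v(1), of "even v"] class_count[OF gr v(1), of "\<not> even v"] bal by simp
qed

text \<open>The compared expressions are twice the numbers of neighbours in the class of
  \<open>v\<close>. A vertex \<open>u\<close> of that class makes the resulting switch preserve
  every balance.\<close>

lemma same_class_exchange:
  assumes gr: "realizes n d E" and v: "v \<in> {1..n}" and p: "p \<in> {1..n}" and q: "q \<in> {1..n}"
    and vpq: "E v q" "\<not> E v p" "v \<noteq> p" and par: "even p = even q"
    and le: "(if even q = even v then int (d q) - bal n E q else int (d q) + bal n E q)
      \<le> (if even p = even v then int (d p) - bal n E p else int (d p) + bal n E p)"
  obtains u where "u \<in> {1..n}" "even u = even v" "E u p" "\<not> E u q" "u \<noteq> q" "u \<noteq> v" "u \<noteq> p"
proof -
  let ?S = "{w \<in> {1..n}. even w = even v}"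
  have "{w \<in> ?S. E w c} = {w \<in> {1..n}. even w = even v \<and> E w c}" for c by blast
  then have c: "2 * int (card {w \<in> ?S. E w c})
      = (if even c = even v then int (d c) - bal n E c else int (d c) + bal n E c)"
    if "c \<in> {1..n}" for c
    using class_count[OF gr that, of "even v"] by simp
  have le': "card {w \<in> ?S. E w q} \<le> card {w \<in> ?S. E w p}"
    using c[OF p] c[OF q] le by linarith
  obtain u where "u \<in> ?S" "E u p" "\<not> E u q" "u \<noteq> q" "u \<noteq> v" "u \<noteq> p"
  proof (rule exchange_vertex[OF _ realizes_sym[OF gr] realizes_irrefl[OF gr] _ vpq _ le'])
    show "finite ?S" "v \<in> ?S" "p \<in> ?S \<longleftrightarrow> q \<in> ?S" using v p q par by auto
  qed
  then show thesis using that by blast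
qed

text \<open>Comparing degrees alone gives no control of the parity of \<open>u\<close>; it serves
  where the balances of \<open>p\<close> and \<open>q\<close> are free.\<close>

lemma any_exchange:
  assumes gr: "realizes n d E" and v: "v \<in> {1..n}" and p: "p \<in> {1..n}" and q: "q \<in> {1..n}"
    and vpq: "E v q" "\<not> E v p" "v \<noteq> p" and le: "d q \<le> d p"
  obtains u where "u \<in> {1..n}" "E u p" "\<not> E u q" "u \<noteq> q" "u \<noteq> v" "u \<noteq> p"
proof -
  have c: "card {w \<in> {1..n}. E w c} = d c" if "c \<in> {1..n}" for c
  proof -
    have "{w \<in> {1..n}. E w c} = nb n E c" using realizes_comm[OF gr] by (auto simp: nb_def)
    then show ?thesis using realizes_card[OF gr that] by simp
  qed
  have le': "card {w \<in> {1..n}. E w q} \<le> card {w \<in> {1..n}. E w p}"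
    using c[OF p] c[OF q] le by simp
  obtain u where "u \<in> {1..n}" "E u p" "\<not> E u q" "u \<noteq> q" "u \<noteq> v" "u \<noteq> p"
    by (rule exchange_vertex[OF _ realizes_sym[OF gr] realizes_irrefl[OF gr] v vpq _ le'])
       (use p q in auto)
  then show thesis using that by blast
qed

lemma switching_realizes:
  assumes "realizes n d E" "E a b" "E c y" "\<not> E a y" "\<not> E c b" "a \<noteq> c" "b \<noteq> y" "a \<noteq> y" "c \<noteq> b"
  shows "switching n d E a b c y"
  using assms by (simp add: switching_def)

lemma even_class:
  assumes mono: "\<And>i j. 1 \<le> i \<Longrightarrow> i \<le> j \<Longrightarrow> j \<le> n \<Longrightarrow> d j \<le> d i"
    and ex: "optimal n d E" "\<And>u. u \<in> {1..n} \<Longrightarrow> odd u \<Longrightarrow> -1 \<le> bal n E u"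
  shows "\<exists>E. optimal n d E \<and> (\<forall>u\<in>{1..n}. -1 \<le> bal n E u)"
proof (rule ccontr)
  assume neg: "\<not> ?thesis"
  define M where "M E \<longleftrightarrow> optimal n d E \<and> (\<forall>u\<in>{1..n}. odd u \<longrightarrow> -1 \<le> bal n E u)" for E
  let ?S = "{u \<in> {1..n}. even u}"
  have bad: "\<exists>u\<in>?S. bal n E u < -1" if "M E" for E
  proof (rule ccontr)
    assume "\<not> ?thesis"
    then have "\<forall>u\<in>{1..n}. -1 \<le> bal n E u" using that by (auto simp: M_def not_less)
    then show False using neg that unfolding M_def by blast
  qed
  have "M E" unfolding M_def using ex by simp
  then obtain v F where v: "v \<in> ?S" and F: "M F" "\<And>u. u \<in> ?S \<Longrightarrow> v < u \<Longrightarrow> -1 \<le> bal n F u" "bal n F v \<le> -2"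
    and Fmax: "\<And>E. M E \<Longrightarrow> (\<And>u. u \<in> ?S \<Longrightarrow> v < u \<Longrightarrow> -1 \<le> bal n E u) \<Longrightarrow> bal n E v \<le> bal n F v"
    by (rule worst_vertex[of M E ?S n, OF _ _ bad]) blast+
  define s where "s = bal n F"
  define D where "D E \<longleftrightarrow> realizes n d E \<and> total n E = total n F \<and> (\<forall>u\<in>{1..n}. bal n E u = s u)" for E
  let ?A = "{u \<in> {1..n}. even u = even v}"
  let ?B = "{u \<in> {1..n}. even u \<noteq> even v}"
  have vV: "v \<in> {1..n}" "even v" using v by auto
  have DF: "D F" using F(1) by (simp add: D_def M_def optimal_def s_def)
  \<comment> \<open>Both weights are twice the number of neighbours in the class of
    \<open>v\<close>, the order that \<open>same_class_exchange\<close> requires.\<close>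
  define \<theta> where "\<theta> y = int (d y) + s y" for y
  define \<kappa> where "\<kappa> x = int (d x) - s x" for x
  obtain yh where yh: "yh \<in> {y \<in> ?B. \<exists>E. D E \<and> \<not> E v y}"
    "\<And>y. y \<in> {y \<in> ?B. \<exists>E. D E \<and> \<not> E v y} \<Longrightarrow> - \<theta> yh \<le> - \<theta> y"
  proof (rule finite_arg_min_int[where g = "\<lambda>y. - \<theta> y"])
    show "finite {y \<in> ?B. \<exists>E. D E \<and> \<not> E v y}" by simp
    have "realizes n d F" using DF by (simp add: D_def)
    then obtain y where "y \<in> {1..n}" "even y \<noteq> even v" "\<not> F v y"
      using hole_exists[OF _ vV(1) F(3)] by blast
    then have "y \<in> {y \<in> ?B. \<exists>E. D E \<and> \<not> E v y}" using DF by auto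
    then show "{y \<in> ?B. \<exists>E. D E \<and> \<not> E v y} \<noteq> {}" by blast
  qed blast
  obtain E0 where E0: "D E0" "\<not> E0 v yh" using yh(1) by blast
  obtain xh where xh: "xh \<in> {x \<in> ?A. \<exists>E. D E \<and> \<not> E v yh \<and> E v x}"
    "\<And>x. x \<in> {x \<in> ?A. \<exists>E. D E \<and> \<not> E v yh \<and> E v x} \<Longrightarrow> \<kappa> xh \<le> \<kappa> x"
  proof (rule finite_arg_min_int[where g = \<kappa>])
    show "finite {x \<in> ?A. \<exists>E. D E \<and> \<not> E v yh \<and> E v x}" by simp
    have gr0: "realizes n d E0" "bal n E0 v \<le> -2" using E0 F(3) vV by (auto simp: D_def s_def)
    have "0 < int (card {w \<in> {1..n}. even w = even v \<and> E0 w v})"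
      using class_count[OF gr0(1) vV(1), of "even v"] gr0(2) by simp
    then have "{w \<in> {1..n}. even w = even v \<and> E0 w v} \<noteq> {}"
      unfolding of_nat_0_less_iff card_gt_0_iff by blast
    then show "{x \<in> ?A. \<exists>E. D E \<and> \<not> E v yh \<and> E v x} \<noteq> {}"
      using E0 realizes_comm[OF gr0(1)] by auto
  qed blast
  obtain G where G: "D G" "\<not> G v yh" "G v xh" using xh(1) by blast
  interpret peg_hole n d D v s \<theta> \<kappa> yh xh G ?A ?B
  proof unfold_locales
    fix E E' assume "D E" "realizes n d E'"
    then show "total n E' \<le> total n E" using F(1) by (simp add: D_def M_def optimal_def)
  next
    fix E assume "D E"
    then show "bal n E v \<le> -2" using F(3) vV(1) by (simp add: D_def s_def)
  next
    fix E u assume "D E" "u \<in> ?A"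
    then show "bal n E u = s u" by (simp add: D_def)
  next
    fix E x assume "D E" "\<not> E v yh" "E v x" "x \<in> ?A"
    then show "\<kappa> xh \<le> \<kappa> x" using xh(2)[of x] by blast
  next
    fix E E' l
    assume a: "D E" "realizes n d E'" "total n E' = total n E" "l \<in> ?A" "l \<noteq> v"
      "bal n E' v = bal n E v + 2" "bal n E' l = bal n E l - 2"
      "\<And>u. u \<in> {1..n} \<Longrightarrow> u \<noteq> v \<Longrightarrow> u \<noteq> l \<Longrightarrow> bal n E' u = bal n E u"
    show "v < l \<and> bal n E l \<le> 0"
    \<comment> \<open>If \<open>l\<close> is below \<open>v\<close>, or still has balance at least
      -1 after losing 2, then \<open>E'\<close> is admissible and beats \<open>F\<close> at
      \<open>v\<close>.\<close>
    proof (rule ccontr)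
      assume neg: "\<not> (v < l \<and> bal n E l \<le> 0)"
      have "total n E' = total n F" using a by (simp add: D_def)
      then have opt: "optimal n d E'" using optimal_total F(1) a(2) M_def by blast
      have eq: "bal n E' u = bal n F u" if "u \<in> {1..n}" "u \<noteq> v" "u \<noteq> l" for u
        using a(1) a(8)[OF that] that by (simp add: D_def s_def)
      have "-1 \<le> bal n E' u" if "u \<in> {1..n}" "odd u" for u
      proof -
        have "u \<noteq> v" "u \<noteq> l" using that a(4) vV by auto
        then show ?thesis using eq[OF that(1)] F(1) that by (simp add: M_def)
      qed
      then have "M E'" using opt by (simp add: M_def)
      moreover have "-1 \<le> bal n E' u" if "u \<in> ?S" "v < u" for u
        using that eq[of u] F(2)[of u] neg a(7) by (cases "u = l") (simp_all add: not_le)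
      ultimately have "bal n E' v \<le> bal n F v" using Fmax by blast
      then show False using a(1,6) vV by (simp add: D_def s_def)
    qed
  next
    fix E E'
    assume a: "D E" "realizes n d E'" "\<And>u. u \<in> {1..n} \<Longrightarrow> bal n E' u = bal n E u"
    have "total n E' = total n E" unfolding total_def using a(3) by (rule sum.cong[OF refl])
    then show "D E'" using a by (simp add: D_def)
  next
    fix E g assume a: "D E" "g \<in> ?B" "\<theta> yh < \<theta> g"
    show "E v g"
    proof (rule ccontr)
      assume "\<not> E v g"
      then have "g \<in> {y \<in> ?B. \<exists>E. D E \<and> \<not> E v y}" using a(1,2) by blast
      then have "- \<theta> yh \<le> - \<theta> g" by (rule yh(2))
      then show False using a(3) by simp
    qed
  next
    fix E y assume a: "D E" "\<not> E v yh" "E v y" "y \<in> ?B" "\<theta> y \<le> \<theta> yh"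
    have gr: "realizes n d E" using a(1) by (simp add: D_def)
    have V: "y \<in> {1..n}" "yh \<in> {1..n}" "even y \<noteq> even v" "even yh \<noteq> even v" "v \<noteq> yh" "v \<noteq> y" "y \<noteq> yh"
      using a yh(1) by auto
    have s: "bal n E y = s y" "bal n E yh = s yh" using a(1) V(1,2) by (auto simp: D_def)
    have par: "even yh = even y" using V(3,4) by simp
    have le: "(if even y = even v then int (d y) - bal n E y else int (d y) + bal n E y)
      \<le> (if even yh = even v then int (d yh) - bal n E yh else int (d yh) + bal n E yh)"
      using a(5) V(3,4) unfolding s \<theta>_def by simp
    obtain u where u: "u \<in> {1..n}" "even u = even v" "E u yh" "\<not> E u y" "u \<noteq> y" "u \<noteq> v" "u \<noteq> yh"
      by (rule same_class_exchange[OF gr vV(1) V(2,1) a(3,2) V(5) par le]) blast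
    interpret sw: switching n d E v y u yh
      by (rule switching_realizes[OF gr]) (use a u V in auto)
    have "total n (switch v y u yh E) = total n E"
      using u(2) V(3,4) by (simp add: sw.total_switch chi_def)
    moreover have "bal n (switch v y u yh E) w = bal n E w" for w
      using u(2) V(3,4) by (simp add: sw.bal_switch chi_def)
    ultimately have "D (switch v y u yh E)"
      using a(1) sw.realizes_switch by (simp add: D_def)
    then show "\<exists>u. u \<noteq> v \<and> u \<noteq> y \<and> u \<noteq> yh \<and> E u yh \<and> \<not> E u y \<and> D (switch v y u yh E)"
      using u by blast
  next
    fix E x x1 assume a: "D E" "\<not> E v yh" "E v x1" "\<not> E v x" "x \<in> ?A" "x1 \<in> ?A" "x \<noteq> v" "\<kappa> x1 \<le> \<kappa> x"
    have gr: "realizes n d E" using a(1) by (simp add: D_def)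
    have V: "x1 \<in> {1..n}" "x \<in> {1..n}" "even x1 = even v" "even x = even v" "v \<noteq> x1" "x \<noteq> x1" "v \<noteq> x"
      using a realizes_irrefl[OF gr] by auto
    have s: "bal n E x1 = s x1" "bal n E x = s x" using a(1) V(1,2) by (auto simp: D_def)
    have par: "even x = even x1" using V(3,4) by simp
    have le: "(if even x1 = even v then int (d x1) - bal n E x1 else int (d x1) + bal n E x1)
      \<le> (if even x = even v then int (d x) - bal n E x else int (d x) + bal n E x)"
      using a(8) V(3,4) unfolding s \<kappa>_def by simp
    obtain u where u: "u \<in> {1..n}" "even u = even v" "E u x" "\<not> E u x1" "u \<noteq> x1" "u \<noteq> v" "u \<noteq> x"
      by (rule same_class_exchange[OF gr vV(1) V(2,1) a(3,4) V(7) par le]) blast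
    interpret sw: switching n d E v x1 u x
      by (rule switching_realizes[OF gr]) (use a u V in auto)
    have "total n (switch v x1 u x E) = total n E"
      using u(2) V(3,4) by (simp add: sw.total_switch chi_def)
    moreover have "bal n (switch v x1 u x E) w = bal n E w" for w
      using u(2) V(3,4) by (simp add: sw.bal_switch chi_def)
    ultimately have "D (switch v x1 u x E)"
      using a(1) sw.realizes_switch by (simp add: D_def)
    then show "\<exists>u. u \<noteq> v \<and> u \<noteq> x \<and> u \<noteq> x1 \<and> E u x \<and> \<not> E u x1 \<and> D (switch v x1 u x E)"
      using u by blast
  qed (use mono vV yh(1) xh(1) G in \<open>simp_all add: D_def\<close>)
  have "1 \<notin> ?A" using v by simp
  then show False by (rule no_hole_if_even)
qed

lemma total_cong: "(\<And>u. u \<in> {1..n} \<Longrightarrow> bal n E' u = bal n E u) \<Longrightarrow> total n E' = total n E"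
  unfolding total_def by (rule sum.cong[OF refl])

lemma odd_class:
  assumes mono: "\<And>i j. 1 \<le> i \<Longrightarrow> i \<le> j \<Longrightarrow> j \<le> n \<Longrightarrow> d j \<le> d i"
    and ex: "optimal n d E"
  shows "\<exists>E. optimal n d E \<and> (\<forall>u\<in>{1..n}. odd u \<longrightarrow> -1 \<le> bal n E u)"
proof (rule ccontr)
  assume neg: "\<not> ?thesis"
  let ?S = "{u \<in> {1..n}. odd u}"
  have bad: "\<exists>u\<in>?S. bal n E u < -1" if "optimal n d E" for E
  proof (rule ccontr)
    assume "\<not> ?thesis"
    then have "\<forall>u\<in>{1..n}. odd u \<longrightarrow> -1 \<le> bal n E u" by (auto simp: not_less)
    then show False using neg that by blast
  qed
  obtain v F where v: "v \<in> ?S" and F: "optimal n d F" "\<And>u. u \<in> ?S \<Longrightarrow> v < u \<Longrightarrow> -1 \<le> bal n F u" "bal n F v \<le> -2"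
    and Fmax: "\<And>E. optimal n d E \<Longrightarrow> (\<And>u. u \<in> ?S \<Longrightarrow> v < u \<Longrightarrow> -1 \<le> bal n E u) \<Longrightarrow> bal n E v \<le> bal n F v"
    by (rule worst_vertex[of "optimal n d" E ?S n, OF ex _ bad]) blast+
  let ?A = "{u \<in> {1..n}. even u = even v}"
  let ?B = "{u \<in> {1..n}. even u \<noteq> even v}"
  have vV: "v \<in> {1..n}" and odd_v: "odd v" using v by auto
  have AS: "?A = ?S" using odd_v by blast
  define K where "K E \<longleftrightarrow> optimal n d E \<and> (\<forall>u\<in>?A. v < u \<longrightarrow> -1 \<le> bal n E u) \<and> bal n E v = bal n F v" for E
  \<comment> \<open>A second extremal choice, needed only when some member has a peg beyond
    \<open>v\<close>.\<close>
  define W where "W E = (\<Sum>u\<in>{u \<in> ?A. v < u}. bal n E u)" for E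
  have "K F" using F(1,2) AS unfolding K_def by blast
  moreover have "W E \<le> int (card {u \<in> ?A. v < u}) * int n" for E
    unfolding W_def by (rule sum_bal_bound) simp
  ultimately obtain E1 where E1: "K E1" and Wmax: "\<And>E. K E \<Longrightarrow> W E \<le> W E1"
    by (rule bounded_arg_max_int[of K F W]) blast+
  define s where "s = bal n E1"
  \<comment> \<open>In the class of \<open>v\<close> only the balances from \<open>v\<close> on are
    fixed; smaller odd labels and all even labels stay free.\<close>
  define D where "D E \<longleftrightarrow> realizes n d E \<and> total n E = total n E1 \<and> bal n E v = bal n F v \<and>
    (\<forall>u\<in>?A. v < u \<longrightarrow> bal n E u = s u)" for E
  have opt1: "optimal n d E1" using E1 by (simp add: K_def)
  have D_E1: "D E1" using E1 opt1 by (simp add: D_def K_def s_def optimal_def)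
  have D_gr: "realizes n d E" if "D E" for E using that by (simp add: D_def)
  have D_opt: "optimal n d E" if "D E" for E
    by (rule optimal_total[OF opt1]) (use that in \<open>simp_all add: D_def\<close>)
  have D_K: "K E" if "D E" for E
    using that D_opt[OF that] E1 by (simp add: K_def D_def s_def)
  have D_v: "bal n E v \<le> -2" if "D E" for E using that F(3) by (simp add: D_def)
  have D_max: "total n E' \<le> total n E" if "D E" "realizes n d E'" for E E'
    using D_opt[OF that(1)] that(2) by (simp add: optimal_def)
  have tok: "v < l \<and> bal n E l \<le> 0"
    if a: "D E" "realizes n d E'" "total n E' = total n E" "l \<noteq> v"
      "bal n E' v = bal n E v + 2" "bal n E' l = bal n E l - 2"
      "\<And>u. u \<in> {1..n} \<Longrightarrow> u \<noteq> v \<Longrightarrow> u \<noteq> l \<Longrightarrow> bal n E' u = bal n E u" for E E' l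
  proof (rule ccontr)
    assume neg: "\<not> (v < l \<and> bal n E l \<le> 0)"
    have opt: "optimal n d E'" using optimal_total[OF D_opt[OF a(1)] a(2,3)] .
    have good: "-1 \<le> bal n E u" if "u \<in> ?A" "v < u" for u
      using D_K[OF a(1)] that unfolding K_def by blast
    have "-1 \<le> bal n E' u" if u: "u \<in> ?S" "v < u" for u
    proof (cases "u = l")
      case True
      then show ?thesis using u neg a(6) by simp
    next
      case False
      have "u \<in> ?A" using u(1) AS by blast
      then have "-1 \<le> bal n E u" using good u(2) by blast
      then show ?thesis using a(7)[of u] u False by simp
    qed
    then have "bal n E' v \<le> bal n F v" by (rule Fmax[OF opt])
    then show False using a(1,5) by (simp add: D_def)
  qed
  define \<theta> where "\<theta> y = - int y" for y
  obtain yh where yh: "yh \<in> {y \<in> ?B. \<exists>E. D E \<and> \<not> E v y}"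
    "\<And>y. y \<in> {y \<in> ?B. \<exists>E. D E \<and> \<not> E v y} \<Longrightarrow> int yh \<le> int y"
  proof (rule finite_arg_min_int[where g = int])
    show "finite {y \<in> ?B. \<exists>E. D E \<and> \<not> E v y}" by simp
    obtain y where "y \<in> {1..n}" "even y \<noteq> even v" "\<not> E1 v y"
      using hole_exists[OF D_gr[OF D_E1] vV D_v[OF D_E1]] by blast
    then have "y \<in> {y \<in> ?B. \<exists>E. D E \<and> \<not> E v y}" using D_E1 by auto
    then show "{y \<in> ?B. \<exists>E. D E \<and> \<not> E v y} \<noteq> {}" by blast
  qed blast
  have yhV: "yh \<in> {1..n}" "even yh" "v \<noteq> yh" using yh(1) odd_v by auto
  have Ymin: "E v g" if "D E" "g \<in> ?B" "g < yh" for E g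
  proof (rule ccontr)
    assume "\<not> E v g"
    then have "g \<in> {y \<in> ?B. \<exists>E. D E \<and> \<not> E v y}" using that(1,2) by blast
    then have "int yh \<le> int g" by (rule yh(2))
    then show False using that(3) by simp
  qed
  have above: "\<exists>x\<in>{1..n}. odd x \<and> E v x \<and> yh < x" if "D E" for E
    by (rule peg_above[OF D_gr[OF that] vV odd_v D_v[OF that] yhV(2)])
       (use Ymin[OF that] odd_v in auto)
  have Yvar: "\<exists>u. u \<noteq> v \<and> u \<noteq> y \<and> u \<noteq> yh \<and> E u yh \<and> \<not> E u y \<and> realizes n d (switch v y u yh E) \<and>
      total n (switch v y u yh E) = total n E \<and> (\<forall>w\<in>?A. bal n (switch v y u yh E) w = bal n E w)"
    if a: "D E" "\<not> E v yh" "E v y" "y \<in> ?B" "\<theta> y \<le> \<theta> yh" for E y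
  proof -
    have gr: "realizes n d E" using a(1) by (rule D_gr)
    have V: "y \<in> {1..n}" "even y" "v \<noteq> y" "y \<noteq> yh" "yh \<le> y"
      using a odd_v by (auto simp: \<theta>_def)
    have le: "d y \<le> d yh" using mono[of yh y] V yhV by simp
    obtain u where u: "u \<in> {1..n}" "E u yh" "\<not> E u y" "u \<noteq> y" "u \<noteq> v" "u \<noteq> yh"
      by (rule any_exchange[OF gr vV yhV(1) V(1) a(3,2) yhV(3) le]) blast
    interpret sw: switching n d E v y u yh
      by (rule switching_realizes[OF gr]) (use a(2,3) u V yhV in auto)
    have "total n (switch v y u yh E) = total n E"
      using V(2) yhV(2) by (simp add: sw.total_switch chi_def)
    moreover have "bal n (switch v y u yh E) w = bal n E w" if "w \<in> ?A" for w
      using that odd_v V(2) yhV(2) by (auto simp: sw.bal_switch chi_def)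
    ultimately show ?thesis using u sw.realizes_switch by blast
  qed
  show False
  proof (cases "\<exists>E x. D E \<and> \<not> E v yh \<and> E v x \<and> x \<in> ?A \<and> v < x")
    case False
    \<comment> \<open>With all pegs before \<open>v\<close>, moving one changes only free balances,
      so degrees suffice. Minimal \<open>\<kappa>\<close> means the largest possible peg.\<close>
    define \<kappa> where "\<kappa> x = - int x" for x
    obtain E0 where E0: "D E0" "\<not> E0 v yh" using yh(1) by blast
    obtain xh where xh: "xh \<in> {x \<in> ?A. \<exists>E. D E \<and> \<not> E v yh \<and> E v x}"
      "\<And>x. x \<in> {x \<in> ?A. \<exists>E. D E \<and> \<not> E v yh \<and> E v x} \<Longrightarrow> \<kappa> xh \<le> \<kappa> x"
    proof (rule finite_arg_min_int[where g = \<kappa>])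
      show "finite {x \<in> ?A. \<exists>E. D E \<and> \<not> E v yh \<and> E v x}" by simp
      show "{x \<in> ?A. \<exists>E. D E \<and> \<not> E v yh \<and> E v x} \<noteq> {}"
        using above[OF E0(1)] E0 odd_v by blast
    qed blast
    obtain G where G: "D G" "\<not> G v yh" "G v xh" using xh(1) by blast
    have before: "x < v" if "D E" "\<not> E v yh" "E v x" "x \<in> ?A" for E x
    proof -
      have "x \<noteq> v" using that realizes_irrefl[OF D_gr[OF that(1)]] by blast
      then show ?thesis using False that by (meson linorder_neqE_nat)
    qed
    interpret ph: peg_hole n d D v s \<theta> \<kappa> yh xh G ?A ?B
    proof unfold_locales
      fix E u assume "D E" "u \<in> ?A" "v < u"
      then show "bal n E u = s u" unfolding D_def by blast
    next
      fix E E' l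
      assume "D E" "realizes n d E'" "total n E' = total n E" "l \<noteq> v"
        "bal n E' v = bal n E v + 2" "bal n E' l = bal n E l - 2"
        "\<And>u. u \<in> {1..n} \<Longrightarrow> u \<noteq> v \<Longrightarrow> u \<noteq> l \<Longrightarrow> bal n E' u = bal n E u"
      then show "v < l \<and> bal n E l \<le> 0" by (rule tok)
    next
      fix E E'
      assume a: "D E" "realizes n d E'" "\<And>u. u \<in> {1..n} \<Longrightarrow> bal n E' u = bal n E u"
      have "total n E' = total n E" using a(3) by (rule total_cong)
      then show "D E'" using a vV by (simp add: D_def)
    next
      fix E g assume "D E" "g \<in> ?B" "\<theta> yh < \<theta> g"
      then show "E v g" using Ymin[of E g] by (simp add: \<theta>_def)
    next
      fix E y assume a: "D E" "\<not> E v yh" "E v y" "y \<in> ?B" "\<theta> y \<le> \<theta> yh"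
      have "D E'" if "realizes n d E'" "total n E' = total n E" "\<forall>w\<in>?A. bal n E' w = bal n E w" for E'
        using that a(1) vV by (simp add: D_def)
      then show "\<exists>u. u \<noteq> v \<and> u \<noteq> y \<and> u \<noteq> yh \<and> E u yh \<and> \<not> E u y \<and> D (switch v y u yh E)"
        using Yvar[OF a] by blast
    next
      fix E x assume "D E" "\<not> E v yh" "E v x" "x \<in> ?A"
      then show "\<kappa> xh \<le> \<kappa> x" using xh(2)[of x] by blast
    next
      fix E x x1 assume a: "D E" "\<not> E v yh" "E v x1" "\<not> E v x" "x \<in> ?A" "x1 \<in> ?A" "x \<noteq> v" "\<kappa> x1 \<le> \<kappa> x"
      have gr: "realizes n d E" using a(1) by (rule D_gr)
      have x1v: "x1 < v" by (rule before[OF a(1,2,3,6)])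
      have V: "x1 \<in> {1..n}" "x \<in> {1..n}" "odd x1" "odd x" "v \<noteq> x1" "x \<noteq> x1" "x \<le> x1"
        using a(3-8) x1v odd_v by (auto simp: \<kappa>_def)
      have le: "d x1 \<le> d x" using mono[of x x1] V by simp
      obtain u where u: "u \<in> {1..n}" "E u x" "\<not> E u x1" "u \<noteq> x1" "u \<noteq> v" "u \<noteq> x"
        by (rule any_exchange[OF gr vV V(2,1) a(3,4) a(7)[symmetric] le]) blast
      interpret sw: switching n d E v x1 u x
        by (rule switching_realizes[OF gr]) (use a(3,4,7) u V in auto)
      have "total n (switch v x1 u x E) = total n E"
        using V(3,4) by (simp add: sw.total_switch chi_def)
      moreover have "bal n (switch v x1 u x E) w = bal n E w" if "v \<le> w" for w
        using that x1v V(3,4,7) by (auto simp: sw.bal_switch chi_def)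
      ultimately have "D (switch v x1 u x E)"
        using a(1) sw.realizes_switch by (simp add: D_def)
      then show "\<exists>u. u \<noteq> v \<and> u \<noteq> x \<and> u \<noteq> x1 \<and> E u x \<and> \<not> E u x1 \<and> D (switch v x1 u x E)"
        using u by blast
    qed (use mono vV yh(1) xh(1) G D_gr D_max D_v in \<open>simp_all\<close>)
    obtain x1 where x1: "x1 \<in> {1..n}" "odd x1" "G v x1" "yh < x1" using above[OF G(1)] by blast
    have x1A: "x1 \<in> ?A" using x1(1,2) odd_v by simp
    have x1v: "x1 < v" by (rule before[OF G(1,2) x1(3) x1A])
    have x1X: "x1 \<in> ph.X" using ph.Xmin[OF G(1,2) x1(3) x1A] x1A x1v unfolding ph.X_def by blast
    have "x1 - 1 \<in> ?B" "yh \<le> x1 - 1" using x1 odd_v yhV by auto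
    then have x1Y: "x1 - 1 \<in> ph.Y" unfolding ph.Y_def by (simp add: \<theta>_def)
    interpret oph: odd_peg_hole n d D v s \<theta> \<kappa> yh xh G ?A ?B
    proof unfold_locales
      show "odd v" by (rule odd_v)
      show "\<theta> y = - int y" for y by (simp add: \<theta>_def)
      fix E E' assume "D E" "realizes n d E'" "total n E' = total n E" "\<And>u. u \<in> ?A \<Longrightarrow> bal n E' u = bal n E u"
      then show "D E'" using vV by (simp add: D_def)
    next
      fix c w assume c: "c \<in> ?A" "c \<notin> ph.X" "c < v" and w: "w \<in> ?B" "G w c"
      have "G w x1"
      proof (rule ccontr)
        assume n: "\<not> G w x1"
        \<comment> \<open>If \<open>w x1\<close> is missing, trading \<open>x1\<close> for
          \<open>c\<close> at \<open>v\<close> changes class balances only before \<open>v\<close>,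
          so it stays in \<open>D\<close> and makes \<open>c\<close> a peg outside
          \<open>X\<close>.\<close>
        have kc: "\<kappa> c < \<kappa> xh" using c unfolding ph.X_def by (auto simp: not_le)
        then have nvc: "\<not> G v c" using ph.Xmin[OF G(1,2) _ c(1)] by (auto simp: not_le)
        have V: "odd c" "even w" "v \<noteq> w" "x1 \<noteq> c" "v \<noteq> c" "w \<noteq> x1" "yh \<noteq> c" "yh \<noteq> x1"
          using c w x1 x1X odd_v yhV(2) by auto
        interpret sw: switching n d G v x1 w c
          by (rule switching_realizes[OF D_gr[OF G(1)]]) (use x1(3) w(2) nvc n V in auto)
        have "total n (switch v x1 w c G) = total n G"
          using V(1,2) x1(2) odd_v by (simp add: sw.total_switch chi_def)
        moreover have "bal n (switch v x1 w c G) u = bal n G u" if "u \<in> ?A" "v \<le> u" for u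
          using that odd_v x1v c(3) V x1(2) by (auto simp: sw.bal_switch chi_def)
        ultimately have "D (switch v x1 w c G)"
          using G(1) sw.realizes_switch vV by (simp add: D_def)
        moreover have "\<not> switch v x1 w c G v yh" "switch v x1 w c G v c"
          using G(2) V yhV x1v by (auto simp: switch_def doubleton_eq_iff)
        ultimately have "\<kappa> xh \<le> \<kappa> c" using c(1) by (rule ph.Xmin)
        then show False using kc by simp
      qed
      then show "\<exists>x\<in>ph.X. x - 1 \<in> ph.Y \<and> G w x" using x1X x1Y by blast
    qed
    show False by (rule oph.no_hole_if_odd)
  next
    case True
    then obtain E2 q where E2: "D E2" "\<not> E2 v yh" and q: "E2 v q" "q \<in> ?A" "v < q" by blast
    obtain p where p: "p \<in> {1..n}" "odd p" "E2 v p" "yh < p" using above[OF E2(1)] by blast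
    \<comment> \<open>The peg must lie beyond \<open>yh\<close>, so that its predecessor is in
      \<open>Y\<close>, and beyond \<open>v\<close>, so that its balance counts in
      \<open>W\<close>.\<close>
    define x2 where "x2 = max p q"
    have x2: "x2 \<in> {1..n}" "odd x2" "E2 v x2" "yh < x2" "v < x2"
      using p q odd_v by (auto simp: x2_def max_def)
    have x2A: "x2 \<in> ?A" using x2(1,2) odd_v by simp
    define t where "t = bal n E2"
    \<comment> \<open>Pegs beyond \<open>v\<close> have fixed balances, so moving them must preserve
      balances. All balances of the class are therefore frozen, and pegs are ranked by neighbours
      inside the class.\<close>
    define D' where "D' E \<longleftrightarrow> realizes n d E \<and> total n E = total n E1 \<and> (\<forall>u\<in>?A. bal n E u = t u)" for E
    have D'D: "D E" if "D' E" for E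
      using that E2(1) vV by (simp add: D'_def D_def t_def)
    have D'E2: "D' E2" using E2(1) by (simp add: D'_def D_def t_def)
    define \<kappa> where "\<kappa> x = int (d x) - t x" for x
    obtain xh where xh: "xh \<in> {x \<in> ?A. \<exists>E. D' E \<and> \<not> E v yh \<and> E v x}"
      "\<And>x. x \<in> {x \<in> ?A. \<exists>E. D' E \<and> \<not> E v yh \<and> E v x} \<Longrightarrow> \<kappa> xh \<le> \<kappa> x"
    proof (rule finite_arg_min_int[where g = \<kappa>])
      show "finite {x \<in> ?A. \<exists>E. D' E \<and> \<not> E v yh \<and> E v x}" by simp
      show "{x \<in> ?A. \<exists>E. D' E \<and> \<not> E v yh \<and> E v x} \<noteq> {}"
        using D'E2 E2(2) x2(3) x2A by blast
    qed blast
    obtain G where G: "D' G" "\<not> G v yh" "G v xh" using xh(1) by blast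
    interpret ph: peg_hole n d D' v t \<theta> \<kappa> yh xh G ?A ?B
    proof unfold_locales
      fix E u assume "D' E" "u \<in> ?A" "v < u"
      then show "bal n E u = t u" unfolding D'_def by blast
    next
      fix E E' l
      assume "D' E" and a: "realizes n d E'" "total n E' = total n E" "l \<noteq> v"
        "bal n E' v = bal n E v + 2" "bal n E' l = bal n E l - 2"
        "\<And>u. u \<in> {1..n} \<Longrightarrow> u \<noteq> v \<Longrightarrow> u \<noteq> l \<Longrightarrow> bal n E' u = bal n E u"
      then have "D E" by (simp add: D'D)
      from this a show "v < l \<and> bal n E l \<le> 0" by (rule tok)
    next
      fix E E'
      assume a: "D' E" "realizes n d E'" "\<And>u. u \<in> {1..n} \<Longrightarrow> bal n E' u = bal n E u"
      have "total n E' = total n E" using a(3) by (rule total_cong)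
      then show "D' E'" using a by (simp add: D'_def)
    next
      fix E g assume "D' E" "g \<in> ?B" "\<theta> yh < \<theta> g"
      then show "E v g" using Ymin[of E g] D'D[of E] by (simp add: \<theta>_def)
    next
      fix E y assume a: "D' E" and b: "\<not> E v yh" "E v y" "y \<in> ?B" "\<theta> y \<le> \<theta> yh"
      have "D' E'" if "realizes n d E'" "total n E' = total n E" "\<forall>w\<in>?A. bal n E' w = bal n E w" for E'
        using that a by (simp add: D'_def)
      then show "\<exists>u. u \<noteq> v \<and> u \<noteq> y \<and> u \<noteq> yh \<and> E u yh \<and> \<not> E u y \<and> D' (switch v y u yh E)"
        using Yvar[OF D'D[OF a] b] by blast
    next
      fix E x assume "D' E" "\<not> E v yh" "E v x" "x \<in> ?A"
      then show "\<kappa> xh \<le> \<kappa> x" using xh(2)[of x] by blast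
    next
      fix E x x1 assume a: "D' E" "\<not> E v yh" "E v x1" "\<not> E v x" "x \<in> ?A" "x1 \<in> ?A" "x \<noteq> v" "\<kappa> x1 \<le> \<kappa> x"
      have gr: "realizes n d E" using a(1) by (simp add: D'_def)
      have V: "x1 \<in> {1..n}" "x \<in> {1..n}" "even x1 = even v" "even x = even v" "v \<noteq> x1" "x \<noteq> x1" "v \<noteq> x"
        using a(3-7) realizes_irrefl[OF gr] by auto
      have bt: "bal n E x1 = t x1" "bal n E x = t x" using a(1,5,6) by (auto simp: D'_def)
      have par: "even x = even x1" using V(3,4) by simp
      have le: "(if even x1 = even v then int (d x1) - bal n E x1 else int (d x1) + bal n E x1)
        \<le> (if even x = even v then int (d x) - bal n E x else int (d x) + bal n E x)"
        using a(8) V(3,4) unfolding bt \<kappa>_def by simp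
      obtain u where u: "u \<in> {1..n}" "even u = even v" "E u x" "\<not> E u x1" "u \<noteq> x1" "u \<noteq> v" "u \<noteq> x"
        by (rule same_class_exchange[OF gr vV V(2,1) a(3,4) V(7) par le]) blast
      interpret sw: switching n d E v x1 u x
        by (rule switching_realizes[OF gr]) (use a(3,4,7) u V in auto)
      have "total n (switch v x1 u x E) = total n E"
        using u(2) V(3,4) by (simp add: sw.total_switch chi_def)
      moreover have "bal n (switch v x1 u x E) w = bal n E w" for w
        using u(2) V(3,4) by (simp add: sw.bal_switch chi_def)
      ultimately have "D' (switch v x1 u x E)"
        using a(1) sw.realizes_switch by (simp add: D'_def)
      then show "\<exists>u. u \<noteq> v \<and> u \<noteq> x \<and> u \<noteq> x1 \<and> E u x \<and> \<not> E u x1 \<and> D' (switch v x1 u x E)"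
        using u by blast
    qed (use mono vV yh(1) xh(1) G D_gr[OF D'D] D_max[OF D'D] D_v[OF D'D] in \<open>simp_all\<close>)
    have x2X: "x2 \<in> ph.X"
      using ph.Xmin[OF D'E2 E2(2) x2(3) x2A] x2A x2(5) unfolding ph.X_def by blast
    have "x2 - 1 \<in> ?B" "yh \<le> x2 - 1" using x2 odd_v yhV by auto
    then have x2Y: "x2 - 1 \<in> ph.Y" unfolding ph.Y_def by (simp add: \<theta>_def)
    interpret oph: odd_peg_hole n d D' v t \<theta> \<kappa> yh xh G ?A ?B
    proof unfold_locales
      show "odd v" by (rule odd_v)
      show "\<theta> y = - int y" for y by (simp add: \<theta>_def)
      fix E E' assume "D' E" "realizes n d E'" "total n E' = total n E" "\<And>u. u \<in> ?A \<Longrightarrow> bal n E' u = bal n E u"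
      then show "D' E'" by (simp add: D'_def)
    next
      fix c w assume c: "c \<in> ?A" "c \<notin> ph.X" "c < v" and w: "w \<in> ?B" "G w c"
      have "G w x2"
      proof (rule ccontr)
        assume n: "\<not> G w x2"
        have kc: "\<kappa> c < \<kappa> xh" using c unfolding ph.X_def by (auto simp: not_le)
        have V: "odd c" "even w" "v \<noteq> w" "x2 \<noteq> c" "v \<noteq> c" "w \<noteq> x2"
          using c w x2(2,5) odd_v by auto
        \<comment> \<open>In the variant with peg \<open>x2\<close>, a missing \<open>w x2\<close>
          would let two units pass from \<open>c < v\<close> to \<open>x2 > v\<close>, against the
          maximality of \<open>W\<close>.\<close>
        obtain E where "ph.peg_variant x2 E" using ph.peg_variant_exists[OF x2X] by blast
        then have E: "D' E" "\<not> E v yh" "E v x2"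
            "\<And>p q. p \<noteq> v \<Longrightarrow> q \<noteq> v \<Longrightarrow> p \<noteq> x2 \<Longrightarrow> q \<noteq> x2 \<Longrightarrow> G p q \<Longrightarrow> E p q"
            "\<And>p. p \<noteq> v \<Longrightarrow> E p x2 \<Longrightarrow> G p x2"
          unfolding ph.peg_variant_def by blast+
        have nvc: "\<not> E v c" using ph.Xmin[OF E(1,2) _ c(1)] kc by (auto simp: not_le)
        have wc: "E w c" using E(4)[of w c] w(2) V by blast
        have nwx: "\<not> E w x2" using E(5)[of w] n V by blast
        note DE = D'D[OF E(1)]
        interpret sw: switching n d E v x2 w c
          by (rule switching_realizes[OF D_gr[OF DE] E(3) wc nvc nwx]) (use V in auto)
        let ?E = "switch v x2 w c E"
        have tot: "total n ?E = total n E"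
          using V(1,2) x2(2) odd_v by (simp add: sw.total_switch chi_def)
        have bx: "bal n ?E x2 = bal n E x2 + 2"
          using V x2(2,5) odd_v by (simp add: sw.bal_switch chi_def)
        have bo: "bal n ?E u = bal n E u" if "u \<in> ?A" "v \<le> u" "u \<noteq> x2" for u
          using that odd_v c(3) V x2(2) by (auto simp: sw.bal_switch chi_def)
        have opt: "optimal n d ?E" using optimal_total[OF D_opt[OF DE] sw.realizes_switch tot] .
        have "-1 \<le> bal n ?E u" if u: "u \<in> ?A" "v < u" for u
        proof -
          have "-1 \<le> bal n E u" using D_K[OF DE] u unfolding K_def by blast
          then show ?thesis using bx bo[of u] u by (cases "u = x2") simp_all
        qed
        moreover have "bal n ?E v = bal n F v" using bo[of v] vV DE x2(5) by (simp add: D_def)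
        ultimately have "K ?E" using opt unfolding K_def by blast
        then have "W ?E \<le> W E1" by (rule Wmax)
        moreover have "W E1 = W E"
          unfolding W_def by (rule sum.cong[OF refl]) (use DE in \<open>simp add: D_def s_def\<close>)
        moreover have "W E < W ?E"
          unfolding W_def
        proof (rule sum_strict_mono_ex1)
          show "\<forall>u\<in>{u \<in> ?A. v < u}. bal n E u \<le> bal n ?E u"
          proof
            fix u assume u: "u \<in> {u \<in> ?A. v < u}"
            show "bal n E u \<le> bal n ?E u" using bx bo[of u] u by (cases "u = x2") simp_all
          qed
          show "\<exists>u\<in>{u \<in> ?A. v < u}. bal n E u < bal n ?E u"
            by (rule bexI[of _ x2]) (use bx x2A x2(5) in simp_all)
        qed simp
        ultimately show False by simp
      qed
      then show "\<exists>x\<in>ph.X. x - 1 \<in> ph.Y \<and> G w x" using x2X x2Y by blast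
    qed
    show False by (rule oph.no_hole_if_odd)
  qed
qed

theorem theorem1p1:
  fixes n :: nat and d :: "nat \<Rightarrow> nat"
  assumes "graphic n d"
    and "\<forall>i j. 1 \<le> i \<and> i \<le> j \<and> j \<le> n \<longrightarrow> d j \<le> d i"
  shows "\<exists>E. simple_graph_on n E \<and> (\<forall>i\<in>{1..n}. degree n E i = d i) \<and>
           (\<forall>i\<in>{1..n}. real (degree n (parity_bisection E) i) \<ge> (real (degree n E i) - 1) / 2)"
proof -
  have mono: "d j \<le> d i" if "1 \<le> i" "i \<le> j" "j \<le> n" for i j
    using assms(2) that by blast
  obtain E0 where "realizes n d E0"
    using assms(1) unfolding graphic_def realizes_def by blast
  then obtain E1 where E1: "optimal n d E1" using optimal_exists by blast
  obtain E2 where E2: "optimal n d E2" "\<forall>u\<in>{1..n}. odd u \<longrightarrow> -1 \<le> bal n E2 u"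
    using odd_class[OF mono E1] by blast
  have "\<exists>E. optimal n d E \<and> (\<forall>u\<in>{1..n}. -1 \<le> bal n E u)"
    by (rule even_class[OF mono E2(1)]) (use E2(2) in auto)
  then obtain E where gr: "realizes n d E" and E: "\<forall>u\<in>{1..n}. -1 \<le> bal n E u"
    unfolding optimal_def by blast
  have "real (degree n (parity_bisection E) i) \<ge> (real (degree n E i) - 1) / 2" if i: "i \<in> {1..n}" for i
  proof -
    have "{u \<in> {1..n}. parity_bisection E i u} = {u \<in> {1..n}. even u = (\<not> even i) \<and> E u i}"
      using realizes_comm[OF gr, of i] by (auto simp: parity_bisection_def)
    then have "2 * int (degree n (parity_bisection E) i) = int (d i) + bal n E i"
      using class_count[OF gr i, of "\<not> even i"] by (simp add: degree_def)
    moreover have "degree n E i = d i" using gr i by (simp add: realizes_def)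
    ultimately have "int (degree n E i) - 1 \<le> 2 * int (degree n (parity_bisection E) i)"
      using E i by simp
    then have "real_of_int (int (degree n E i) - 1) \<le> real_of_int (2 * int (degree n (parity_bisection E) i))"
      by (simp only: of_int_le_iff)
    then show ?thesis by simp
  qed
  then show ?thesis using gr unfolding realizes_def by blast
qed

end
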